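(* Let $K$ be a field and let $s,r\in\mathbb{Z}_{\geq 0}$. For each $i\in[s]$ and $j\in[r]$ let $d_{ij}\in\mathbb{Z}_{\geq 0}$ and set $V_{ij}:=K^{d_{ij}}$. For each $i\in[s]$, let $X_i\subseteq\prod_{j=1}^r V_{ij}$ be a Hadamard-stable Zariski-closed subset. Then there exists $D\in\mathbb{Z}_{\geq 0}$ such that for any exponents $a_1,\ldots,a_s\in\mathbb{Z}_{\geq 0}$ the ideal of $X_1^{*a_1}*\cdots*X_s^{*a_s}\subseteq\prod_{j=1}^r\bigotimes_{i=1}^s V_{ij}^{\otimes a_i}$ is generated by polynomials of degree at most $D$.
   Context: Notation: $[s]=\{1,\ldots,s\}$. The ideal of a Zariski-closed subset of a finite-dimensional $K$-vector space is the ideal of all polynomials over $K$ vanishing on it. Hadamard product: on $K^d$ it is $(a_1,\ldots,a_d)\bigcirc(b_1,\ldots,b_d)=(a_1b_1,\ldots,a_db_d)$; on a product $\prod_j K^{d_j}$ it is defined component-wise. A subset $X\subseteq\prod_j K^{d_j}$ is Hadamard-stable if it contains the all-one vector and $x\bigcirc z\in X$ for all $x,z\in X$. Toric fibre product: for finite-dimensional $K$-vector spaces $U_1,\ldots,U_r,V_1,\ldots,V_r$ define the bilinear operation $\prod_jU_j\times\prod_jV_j\to\prod_j(U_j\otimes V_j)$, $(u,v)\mapsto u*v:=(u_1\otimes v_1,\ldots,u_r\otimes v_r)$. For Zariski-closed $X\subseteq\prod_jU_j$ and $Y\subseteq\prod_jV_j$, the toric fibre product $X*Y\subseteq\prod_j(U_j\otimes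 V_j)$ is the Zariski closure of $\{u*v\mid u\in X,\ v\in Y\}$. The operation $*$ on closed sets is associative and commutative up to reordering tensor factors, so it can be iterated; concretely $X_1^{*a_1}*\cdots*X_s^{*a_s}$ is the Zariski closure in $\prod_{j=1}^r\bigotimes_{i=1}^sV_{ij}^{\otimes a_i}$ of the set of all tuples $\big(\bigotimes_{i=1}^s\bigotimes_{k=1}^{a_i}v_{ijk}\big)_{j\in[r]}$ where $(v_{ijk})_{j\in[r]}\in X_i$ for all $i\in[s]$ and $k\in[a_i]$ (an empty tensor product of vector spaces is $K$, and an empty tensor product of vectors is $1\in K$). *)

theory Defs
  imports "HOL.Hull" "HOL-Algebra.Ideal" "HOL-Library.Poly_Mapping" "HOL-Library.FuncSet"
begin

section \<open>Coordinate spaces and polynomials\<close>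

text \<open>The space \<open>K\<close>-to-the-\<open>B\<close> with coordinates indexed by a set \<open>B\<close>, which is finite in all
  applications; points are extensional functions. The field \<open>K\<close> is the type \<open>'k\<close>.\<close>

definition coord_space :: "'c set \<Rightarrow> ('c \<Rightarrow> 'k) set" where
  "coord_space B = B \<rightarrow>\<^sub>E UNIV"

text \<open>A polynomial is a finitely supported function from monomials to coefficients, and a monomial is
  a finitely supported function from variables to exponents. Multiplication is the convolution
  product of \<^theory>\<open>HOL-Library.Poly_Mapping\<close>.\<close>

type_synonym ('c, 'k) mpoly = "('c \<Rightarrow>\<^sub>0 nat) \<Rightarrow>\<^sub>0 'k"

definition polys :: "'c set \<Rightarrow> ('c, 'k::field) mpoly set" where
  "polys B = {p. \<forall>m \<in> Poly_Mapping.keys p. Poly_Mapping.keys m \<subseteq> B}"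

definition poly_ring :: "'c set \<Rightarrow> ('c, 'k::field) mpoly ring" where
  "poly_ring B = \<lparr>carrier = polys B, mult = (*), one = 1, zero = 0, add = (+)\<rparr>"

definition poly_eval :: "('c, 'k::field) mpoly \<Rightarrow> ('c \<Rightarrow> 'k) \<Rightarrow> 'k" where
  "poly_eval p x =
     (\<Sum>m \<in> Poly_Mapping.keys p. Poly_Mapping.lookup p m *
        (\<Prod>c \<in> Poly_Mapping.keys m. x c ^ Poly_Mapping.lookup m c))"

definition monom_deg :: "('c \<Rightarrow>\<^sub>0 nat) \<Rightarrow> nat" where
  "monom_deg m = (\<Sum>c \<in> Poly_Mapping.keys m. Poly_Mapping.lookup m c)"

definition deg_le :: "('c, 'k::field) mpoly \<Rightarrow> nat \<Rightarrow> bool" where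
  "deg_le p D \<longleftrightarrow> (\<forall>m \<in> Poly_Mapping.keys p. monom_deg m \<le> D)"

definition zariski_closed :: "'c set \<Rightarrow> ('c \<Rightarrow> 'k::field) set \<Rightarrow> bool" where
  "zariski_closed B X \<longleftrightarrow>
     (\<exists>P \<subseteq> polys B. X = {x \<in> coord_space B. \<forall>p \<in> P. poly_eval p x = 0})"

definition vanishing_ideal :: "'c set \<Rightarrow> ('c \<Rightarrow> 'k::field) set \<Rightarrow> ('c, 'k) mpoly set" where
  "vanishing_ideal B X = {p \<in> polys B. \<forall>x \<in> X. poly_eval p x = 0}"

definition generated_in_degree_le :: "'c set \<Rightarrow> ('c, 'k::field) mpoly set \<Rightarrow> nat \<Rightarrow> bool" where
  "generated_in_degree_le B J D \<longleftrightarrow>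
     (\<exists>G \<subseteq> polys B. (\<forall>g \<in> G. deg_le g D) \<and> J = Idl\<^bsub>poly_ring B\<^esub> G)"

section \<open>Hadamard-stable sets\<close>

definition hadamard :: "'c set \<Rightarrow> ('c \<Rightarrow> 'k::field) \<Rightarrow> ('c \<Rightarrow> 'k) \<Rightarrow> ('c \<Rightarrow> 'k)" where
  "hadamard B x z = (\<lambda>c\<in>B. x c * z c)"

definition hadamard_stable :: "'c set \<Rightarrow> ('c \<Rightarrow> 'k::field) set \<Rightarrow> bool" where
  "hadamard_stable B X \<longleftrightarrow>
     X \<subseteq> coord_space B \<and> (\<lambda>c\<in>B. 1) \<in> X \<and> (\<forall>x \<in> X. \<forall>z \<in> X. hadamard B x z \<in> X)"

section \<open>Toric fibre products\<close>

text \<open>All index sets are shifted to start at \<open>0\<close>. The coordinates of the product over \<open>j < r\<close> of the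
  spaces \<open>K\<close>-to-the-\<open>n j\<close> are the pairs \<open>(j, l)\<close> with \<open>l < n j\<close>.\<close>

definition prod_coords :: "nat \<Rightarrow> (nat \<Rightarrow> nat) \<Rightarrow> (nat \<times> nat) set" where
  "prod_coords r n = (SIGMA j:{..<r}. {..<n j})"

text \<open>The pair \<open>(i, k)\<close> stands for the \<open>k\<close>-th of the \<open>a i\<close> factors of type \<open>i\<close>.\<close>

definition factors :: "nat \<Rightarrow> (nat \<Rightarrow> nat) \<Rightarrow> (nat \<times> nat) set" where
  "factors s a = (SIGMA i:{..<s}. {..<a i})"

text \<open>A tensor product of coordinate spaces is the coordinate space on the product of the index sets:
  the multi-index \<open>\<mu>\<close> stands for the tensor product of the standard basis vectors with indices
  \<open>\<mu> (i, k) < d i j\<close>, and the \<open>\<mu>\<close>-coordinate of a pure tensor is the product of the \<open>\<mu> (i, k)\<close>-th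
  coordinates of its factors. If there are no factors then there is exactly one multi-index,
  so the empty tensor product is \<open>K\<close> and the empty tensor of vectors is \<open>1\<close>. The pair \<open>(j, \<mu>)\<close> is a
  coordinate on the \<open>j\<close>-th component.\<close>

definition tensor_coords ::
    "nat \<Rightarrow> nat \<Rightarrow> (nat \<Rightarrow> nat \<Rightarrow> nat) \<Rightarrow> (nat \<Rightarrow> nat) \<Rightarrow> (nat \<times> (nat \<times> nat \<Rightarrow> nat)) set" where
  "tensor_coords s r d a = (SIGMA j:{..<r}. \<Pi>\<^sub>E (i, k) \<in> factors s a. {..<d i j})"

definition pure_tensor ::
    "nat \<Rightarrow> nat \<Rightarrow> (nat \<Rightarrow> nat \<Rightarrow> nat) \<Rightarrow> (nat \<Rightarrow> nat) \<Rightarrow> (nat \<Rightarrow> nat \<Rightarrow> nat \<times> nat \<Rightarrow> 'k::field)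
      \<Rightarrow> nat \<times> (nat \<times> nat \<Rightarrow> nat) \<Rightarrow> 'k" where
  "pure_tensor s r d a v =
     (\<lambda>(j, \<mu>) \<in> tensor_coords s r d a. \<Prod>(i, k) \<in> factors s a. v i k (j, \<mu> (i, k)))"

text \<open>The iterated product of \<open>a i\<close> copies of \<open>X i\<close> for all \<open>i < s\<close>; the \<open>hull\<close> is the Zariski closure
  in the coordinate space on \<^term>\<open>tensor_coords s r d a\<close>.\<close>

definition toric_fibre_power ::
    "nat \<Rightarrow> nat \<Rightarrow> (nat \<Rightarrow> nat \<Rightarrow> nat) \<Rightarrow> (nat \<Rightarrow> (nat \<times> nat \<Rightarrow> 'k::field) set) \<Rightarrow> (nat \<Rightarrow> nat)
      \<Rightarrow> (nat \<times> (nat \<times> nat \<Rightarrow> nat) \<Rightarrow> 'k) set" where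
  "toric_fibre_power s r d X a =
     zariski_closed (tensor_coords s r d a) hull
       {pure_tensor s r d a v | v. \<forall>(i, k) \<in> factors s a. v i k \<in> X i}"

section \<open>Basic facts\<close>

lemma polys_closed:
  "0 \<in> polys B" "1 \<in> polys B"
  "p \<in> polys B \<Longrightarrow> q \<in> polys B \<Longrightarrow> p + q \<in> polys B"
  "p \<in> polys B \<Longrightarrow> q \<in> polys B \<Longrightarrow> p * q \<in> polys B"
  "p \<in> polys B \<Longrightarrow> - p \<in> polys B"
proof -
  show "0 \<in> polys B" "1 \<in> polys B"
    by (auto simp: polys_def)
  show "p + q \<in> polys B" if "p \<in> polys B" "q \<in> polys B"
    using that keys_add[of p q] unfolding polys_def by blast
  show "- p \<in> polys B" if "p \<in> polys B"
    using that by (simp add: polys_def)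
  show "p * q \<in> polys B" if p: "p \<in> polys B" and q: "q \<in> polys B"
    unfolding polys_def
  proof safe
    fix m c assume "m \<in> Poly_Mapping.keys (p * q)" and c: "c \<in> Poly_Mapping.keys m"
    then obtain a b where "m = a + b" "a \<in> Poly_Mapping.keys p" "b \<in> Poly_Mapping.keys q"
      using keys_mult[of p q] by blast
    with c p q show "c \<in> B"
      using keys_add[of a b] unfolding polys_def by blast
  qed
qed

lemma poly_ring_cring: "cring (poly_ring B)"
proof (rule cringI)
  show "abelian_group (poly_ring B)"
  proof (rule abelian_groupI)
    fix p assume "p \<in> carrier (poly_ring B)"
    then show "\<exists>q \<in> carrier (poly_ring B). q \<oplus>\<^bsub>poly_ring B\<^esub> p = \<zero>\<^bsub>poly_ring B\<^esub>"
      by (intro bexI[of _ "- p"]) (simp_all add: poly_ring_def polys_closed)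
  qed (simp_all add: poly_ring_def polys_closed add_ac)
  show "comm_monoid (poly_ring B)"
    by (rule comm_monoidI) (auto simp: poly_ring_def polys_closed mult_ac)
qed (simp add: poly_ring_def distrib_right)

lemma zariski_closed_hull:
  assumes "S \<subseteq> coord_space B"
  shows "zariski_closed B (zariski_closed B hull S)"
proof -
  let ?P = "vanishing_ideal B S"
  have "zariski_closed B hull S = {x \<in> coord_space B. \<forall>p \<in> ?P. poly_eval p x = 0}" (is "_ = ?Z")
  proof (rule hull_unique)
    show "S \<subseteq> ?Z"
      using assms by (auto simp: vanishing_ideal_def)
    have "?P \<subseteq> polys B"
      by (auto simp: vanishing_ideal_def)
    then show "zariski_closed B ?Z"
      unfolding zariski_closed_def by blast
    fix T assume "S \<subseteq> T" "zariski_closed B T"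
    then obtain P where P: "P \<subseteq> polys B" "T = {x \<in> coord_space B. \<forall>p \<in> P. poly_eval p x = 0}"
      unfolding zariski_closed_def by blast
    with \<open>S \<subseteq> T\<close> have "P \<subseteq> ?P"
      unfolding vanishing_ideal_def by blast
    with P(2) show "?Z \<subseteq> T"
      by blast
  qed
  moreover have "?P \<subseteq> polys B"
    by (auto simp: vanishing_ideal_def)
  ultimately show ?thesis
    unfolding zariski_closed_def by blast
qed

lemma pure_tensor_in_coord_space: "pure_tensor s r d a v \<in> coord_space (tensor_coords s r d a)"
  by (simp add: pure_tensor_def coord_space_def)

end

theory Submission
  imports Defs "HOL-Library.Infinite_Set" "HOL-Library.Multiset_Order" "HOL-Library.Product_Lexorder"
begin

text \<open>A Hadamard-stable set is a monoid on which the monomials are characters. By the independence of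
  characters its vanishing ideal is spanned by differences of two monomials, and the same holds for
  the set of pure tensors. A monomial on the tensor product is a table whose columns are monomials on
  the factors, and two monomials agree on the pure tensors if and only if their columns agree on the
  factors. So it suffices to connect such tables by moves of bounded degree. Tables with equal columns are
  connected by swaps of two entries; tables of equal multidegree are connected by changing one column
  at a time, which takes moves of bounded degree by Dickson's lemma; finally, the multidegree of a table
  is lowered within its class by moves that are bounded because monomial ideals are
  well-quasi-ordered by reverse inclusion (Maclagan).\<close>

text \<open>The bound must not depend on the number of factors, so a move may touch every column of
  a table but only boundedly many rows. Columns with a common multidegree always fit together to a
  table. This makes steps inside one multidegree easy: one column is altered and the others are
  carried along. The obstacle is a change of multidegree, because it concerns all columns
  simultaneously: every column must contain a piece of the same bounded multidegree \<open>f\<close>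
  that can be traded for a piece of the same multidegree \<open>f'\<close>. Dickson's lemma for
  single monomials would yield a different \<open>f\<close> for each column. The way out is to
  compare pairs \<open>(e, e')\<close> of multidegrees instead of monomials. Such a pair determines,
  for each of the finitely many types of factors, the ideal generated by all monomials of
  multidegree \<open>e\<close> that agree with one of multidegree \<open>e'\<close>. Finitely many
  pairs dominate all others in each of these ideals at once, and copies of one type share an ideal,
  so the number of copies never enters.\<close>

section \<open>Well-quasi-orders\<close>

text \<open>Goodness of sequences is the only clause: the main instance \<open>dominates\<close>
  compares generating sets of ideals and is not antisymmetric.\<close>

definition wqo_on :: "('q \<Rightarrow> 'q \<Rightarrow> bool) \<Rightarrow> 'q set \<Rightarrow> bool" where
  "wqo_on R S \<longleftrightarrow> (\<forall>x :: nat \<Rightarrow> 'q. range x \<subseteq> S \<longrightarrow> (\<exists>i j. i < j \<and> R (x i) (x j)))"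

lemma wqo_onD:
  assumes "wqo_on R S" "range x \<subseteq> S"
  obtains i j :: nat where "i < j" "R (x i) (x j)"
  using assms unfolding wqo_on_def by blast

lemma wqo_on_subset: "wqo_on R S \<Longrightarrow> T \<subseteq> S \<Longrightarrow> wqo_on R T"
  unfolding wqo_on_def by (meson order_trans)

text \<open>Only finitely many indices have no later element above them, since infinitely many would
  form a bad subsequence. Beyond these, successors can be chosen forever.\<close>

lemma wqo_on_mono_subseq:
  assumes wqo: "wqo_on R S" and tr: "transp R" and x: "range x \<subseteq> S"
  shows "\<exists>h :: nat \<Rightarrow> nat. strict_mono h \<and> (\<forall>i j. i < j \<longrightarrow> R (x (h i)) (x (h j)))"
proof -
  define T where "T = {i. \<forall>j>i. \<not> R (x i) (x j)}"
  have "finite T"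
  proof (rule ccontr)
    assume T: "infinite T"
    have "range (x \<circ> enumerate T) \<subseteq> S"
      using x by auto
    from wqo_onD[OF wqo this] obtain i j where "i < j" "R (x (enumerate T i)) (x (enumerate T j))"
      by auto
    moreover have "enumerate T i \<in> T" "enumerate T i < enumerate T j"
      using \<open>i < j\<close> T enumerate_in_set enumerate_mono by blast+
    ultimately show False
      unfolding T_def by blast
  qed
  then obtain N where N: "\<forall>i\<in>T. i < N"
    by (auto simp: finite_nat_set_iff_bounded)
  have "\<exists>h :: nat \<Rightarrow> nat. \<forall>n. N \<le> h n \<and> (h n < h (Suc n) \<and> R (x (h n)) (x (h (Suc n))))"
  proof (rule dependent_nat_choice)
    show "\<exists>y. N \<le> y"
      by blast
    fix y n :: nat assume "N \<le> y"
    then have "y \<notin> T"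
      using N by fastforce
    then show "\<exists>z. N \<le> z \<and> (y < z \<and> R (x y) (x z))"
      using \<open>N \<le> y\<close> unfolding T_def by fastforce
  qed
  then obtain h where h: "\<And>n. h n < h (Suc n)" "\<And>n. R (x (h n)) (x (h (Suc n)))"
    by blast
  have "R (x (h i)) (x (h j))" if "i < j" for i j
    using that
  proof (induction j)
    case (Suc j)
    then show ?case
      using h(2)[of j] transpD[OF tr] by (cases "i = j") (auto simp: less_Suc_eq)
  qed simp
  with h(1) show ?thesis
    by (intro exI[of _ h]) (simp add: strict_mono_Suc_iff)
qed

text \<open>The subsequence is refined once per index; what is already monotone stays monotone. This
  replaces a separate treatment of finite products of well-quasi-orders.\<close>

lemma wqo_on_common_mono_subseq:
  assumes "finite I" and tr: "transp R"
    and "\<And>i. i \<in> I \<Longrightarrow> wqo_on R (S i)" "\<And>i. i \<in> I \<Longrightarrow> range (x i) \<subseteq> S i"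
  shows "\<exists>h :: nat \<Rightarrow> nat. strict_mono h \<and>
    (\<forall>i\<in>I. \<forall>m n. m < n \<longrightarrow> R (x i (h m)) (x i (h n)))"
  using assms(1,3,4)
proof (induction I rule: finite_induct)
  case empty
  show ?case
    by (intro exI[of _ id]) (simp add: strict_mono_def)
next
  case (insert i I)
  have "\<exists>h :: nat \<Rightarrow> nat. strict_mono h \<and> (\<forall>i\<in>I. \<forall>m n. m < n \<longrightarrow> R (x i (h m)) (x i (h n)))"
    by (rule insert.IH) (use insert.prems in auto)
  then obtain h :: "nat \<Rightarrow> nat" where h: "strict_mono h"
    "\<And>i m n. i \<in> I \<Longrightarrow> m < n \<Longrightarrow> R (x i (h m)) (x i (h n))"
    by blast
  have "range (x i \<circ> h) \<subseteq> S i"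
    using insert.prems(2)[of i] by auto
  from wqo_on_mono_subseq[OF insert.prems(1)[of i] tr this]
  obtain g :: "nat \<Rightarrow> nat" where g: "strict_mono g" "\<forall>m n. m < n \<longrightarrow> R (x i (h (g m))) (x i (h (g n)))"
    by auto
  have "R (x k (h (g m))) (x k (h (g n)))" if "k \<in> insert i I" "m < n" for k m n
    using that g h(2) strict_monoD[OF g(1)] by auto
  moreover have "strict_mono (\<lambda>n. h (g n))"
    using g(1) h(1) by (simp add: strict_mono_def)
  ultimately show ?case
    by (intro exI[of _ "\<lambda>n. h (g n)"]) simp
qed

text \<open>Without a finite basis, one can keep choosing elements that are above none of the
  earlier ones, which gives a bad sequence.\<close>

lemma finite_basis_of_good:
  assumes good: "\<And>x :: nat \<Rightarrow> 'e. range x \<subseteq> E \<Longrightarrow> \<exists>i j. i < j \<and> R (x i) (x j)"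
  shows "\<exists>F. finite F \<and> F \<subseteq> E \<and> (\<forall>e\<in>E. \<exists>f\<in>F. R f e)"
proof (rule ccontr)
  assume "\<not> ?thesis"
  then have nofin: "\<exists>e\<in>E. \<forall>f\<in>F. \<not> R f e" if "finite F" "F \<subseteq> E" for F
    using that by simp
  define P :: "'e set \<times> 'e \<Rightarrow> bool" where
    "P = (\<lambda>(F, e). finite F \<and> F \<subseteq> E \<and> e \<in> E \<and> (\<forall>f\<in>F. \<not> R f e))"
  define Q :: "'e set \<times> 'e \<Rightarrow> 'e set \<times> 'e \<Rightarrow> bool" where
    "Q = (\<lambda>(F, e) (F', e'). F' = insert e F)"
  have "\<exists>X :: nat \<Rightarrow> 'e set \<times> 'e. \<forall>n. P (X n) \<and> Q (X n) (X (Suc n))"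
  proof (rule dependent_nat_choice[of "\<lambda>_. P" "\<lambda>_. Q"])
    show "\<exists>x. P x"
    proof -
      obtain e where "e \<in> E"
        using nofin[of "{}"] by blast
      then show ?thesis
        by (intro exI[of _ "({}, e)"]) (simp add: P_def)
    qed
    fix x assume "P x"
    then obtain F e where x: "x = (F, e)" and F: "finite (insert e F)" "insert e F \<subseteq> E"
      by (cases x) (auto simp: P_def)
    from F obtain e' where "e' \<in> E" "\<forall>f\<in>insert e F. \<not> R f e'"
      using nofin[of "insert e F"] by blast
    with F show "\<exists>y. P y \<and> Q x y"
      by (intro exI[of _ "(insert e F, e')"]) (simp add: x P_def Q_def)
  qed
  then obtain X where "\<forall>n. P (X n) \<and> Q (X n) (X (Suc n))" ..
  then have PX: "\<And>n. P (X n)" and QX: "\<And>n. Q (X n) (X (Suc n))"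
    by simp_all
  have X: "fst (X n) \<subseteq> E" "snd (X n) \<in> E" "\<And>f. f \<in> fst (X n) \<Longrightarrow> \<not> R f (snd (X n))"
    "fst (X (Suc n)) = insert (snd (X n)) (fst (X n))" for n
    using PX[of n] QX[of n] by (auto simp: P_def Q_def split: prod.splits)
  have mem: "snd (X i) \<in> fst (X j)" if "i < j" for i j
    using that
  proof (induction j)
    case (Suc j)
    then show ?case
      using X(4)[of j] by (cases "i = j") auto
  qed simp
  have "range (snd \<circ> X) \<subseteq> E"
    using X(2) by auto
  from good[OF this] obtain i j where "i < j" "R (snd (X i)) (snd (X j))"
    by auto
  with mem[of i j] X(3)[of "snd (X i)" j] show False
    by simp
qed

section \<open>Antitone sequences over a well-quasi-order\<close>

text \<open>Pointwise comparison of antitone sequences over a well-quasi-order \<open>S\<close> is again a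
  well-quasi-order. A bad sequence of such sequences yields some \<open>q \<in> S\<close> and a bad sequence over the
  elements of \<open>S\<close> that are not above \<open>q\<close>; iterating this gives a bad sequence in \<open>S\<close>.\<close>

definition antitone_good :: "('q \<Rightarrow> 'q \<Rightarrow> bool) \<Rightarrow> 'q set \<Rightarrow> bool" where
  "antitone_good R S \<longleftrightarrow> (\<forall>f :: nat \<Rightarrow> nat \<Rightarrow> 'q.
     (\<forall>n. range (f n) \<subseteq> S \<and> (\<forall>t u. t \<le> u \<longrightarrow> R (f n u) (f n t))) \<longrightarrow>
     (\<exists>i j. i < j \<and> (\<forall>t. R (f i t) (f j t))))"

lemma antitone_goodD:
  fixes f :: "nat \<Rightarrow> nat \<Rightarrow> 'q"
  assumes "antitone_good R S" "\<And>n. range (f n) \<subseteq> S" "\<And>n t u. t \<le> u \<Longrightarrow> R (f n u) (f n t)"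
  shows "\<exists>i j. i < j \<and> (\<forall>t. R (f i t) (f j t))"
  using assms(1)[unfolded antitone_good_def, THEN spec, of f] assms(2,3) by simp

lemma antitone_good_step:
  fixes R :: "'q \<Rightarrow> 'q \<Rightarrow> bool"
  assumes wqo: "wqo_on R S" and tr: "transp R"
    and residual: "\<And>q. q \<in> S \<Longrightarrow> antitone_good R {x \<in> S. \<not> R q x}"
  shows "antitone_good R S"
  unfolding antitone_good_def
proof (intro allI impI)
  fix f :: "nat \<Rightarrow> nat \<Rightarrow> 'q"
  assume f: "\<forall>n. range (f n) \<subseteq> S \<and> (\<forall>t u. t \<le> u \<longrightarrow> R (f n u) (f n t))"
  have trans: "R a b \<Longrightarrow> R b c \<Longrightarrow> R a c" for a b c
    using tr unfolding transp_def by blast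
  have fS: "f n t \<in> S" and anti: "t \<le> u \<Longrightarrow> R (f n u) (f n t)" for n t u
    using f by auto
  \<comment> \<open>Up to equivalence an antitone sequence becomes constant: it is already minimal
    at the first index of a monotone subsequence.\<close>
  have "\<exists>T. \<forall>t. R (f n T) (f n t)" for n
  proof -
    have "range (f n) \<subseteq> S"
      using fS by auto
    from wqo_on_mono_subseq[OF wqo tr this] obtain h :: "nat \<Rightarrow> nat" where h: "strict_mono h"
      "\<forall>i j. i < j \<longrightarrow> R (f n (h i)) (f n (h j))"
      by auto
    have "R (f n (h 0)) (f n t)" for t
    proof -
      have "t \<le> h (Suc t)"
        using strict_mono_imp_increasing[OF h(1), of "Suc t"] by simp
      then show ?thesis
        using anti[of t "h (Suc t)" n] h(2) trans by blast
    qed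
    then show ?thesis
      by blast
  qed
  then obtain T where T: "\<And>n t. R (f n (T n)) (f n t)"
    by metis
  have "range (\<lambda>n. f n (T n)) \<subseteq> S"
    using fS by auto
  from wqo_on_mono_subseq[OF wqo tr this] obtain h :: "nat \<Rightarrow> nat" where h: "strict_mono h"
    "\<forall>i j. i < j \<longrightarrow> R (f (h i) (T (h i))) (f (h j) (T (h j)))"
    by auto
  show "\<exists>i j. i < j \<and> (\<forall>t. R (f i t) (f j t))"
  proof (rule ccontr)
    assume bad: "\<not> ?thesis"
    \<comment> \<open>From \<open>T (h 0)\<close> on the comparison follows from that of the minimal
      values, so it can only fail at one of finitely many positions. Hence infinitely many
      \<open>m\<close> fail at one position \<open>t0\<close>.\<close>
    have "\<exists>t < T (h 0). \<not> R (f (h 0) t) (f (h (Suc m)) t)" for m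
    proof -
      have "h 0 < h (Suc m)"
        using strict_monoD[OF h(1)] by simp
      with bad obtain t where t: "\<not> R (f (h 0) t) (f (h (Suc m)) t)"
        by blast
      have "R (f (h 0) t) (f (h 0) (T (h 0)))" if "T (h 0) \<le> t"
        using anti that by blast
      moreover have "R (f (h 0) (T (h 0))) (f (h (Suc m)) t)"
        using trans[OF _ T[of "h (Suc m)" t]] h(2) by blast
      ultimately show ?thesis
        using t trans not_less by blast
    qed
    then obtain \<tau> where \<tau>: "\<And>m. \<tau> m < T (h 0)" "\<And>m. \<not> R (f (h 0) (\<tau> m)) (f (h (Suc m)) (\<tau> m))"
      by metis
    have "range \<tau> \<subseteq> {..<T (h 0)}"
      using \<tau>(1) by auto
    then have "finite (range \<tau>)"
      using finite_subset by blast
    then obtain m0 where m0: "infinite {m. \<tau> m = \<tau> m0}"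
      using pigeonhole_infinite[of UNIV \<tau>] by auto
    define t0 where "t0 = \<tau> m0"
    define M where "M = {m. \<tau> m = t0}"
    define g where "g n = f (h (Suc (enumerate M n)))" for n
    define q where "q = f (h 0) t0"
    have M: "infinite M"
      using m0 by (simp add: M_def t0_def)
    have nq: "\<not> R q (g n t0)" for n
      using \<tau>(2)[of "enumerate M n"] enumerate_in_set[OF M, of n] by (simp add: g_def q_def M_def)
    have gf: "g n t \<in> S" "t \<le> u \<Longrightarrow> R (g n u) (g n t)" for n t u
      using fS anti by (simp_all add: g_def)
    \<comment> \<open>The finitely many positions before \<open>t0\<close> are made monotone by a
      common subsequence. From \<open>t0\<close> on, the values stay outside the up-set of
      \<open>q\<close>, because they do not rise above the value at \<open>t0\<close>.\<close>
    have "range (\<lambda>n. g n t) \<subseteq> S" for t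
      using gf(1) by auto
    then have "\<exists>k :: nat \<Rightarrow> nat. strict_mono k \<and>
        (\<forall>t\<in>{..<t0}. \<forall>m n. m < n \<longrightarrow> R (g (k m) t) (g (k n) t))"
      using wqo tr by (intro wqo_on_common_mono_subseq[of "{..<t0}" R "\<lambda>_. S" "\<lambda>t n. g n t"]) simp_all
    then obtain k :: "nat \<Rightarrow> nat" where k: "strict_mono k"
      "\<And>t m n. t < t0 \<Longrightarrow> m < n \<Longrightarrow> R (g (k m) t) (g (k n) t)"
      by auto
    define g' where "g' n t = g (k n) (t0 + t)" for n t
    have "q \<in> S"
      using fS by (simp add: q_def)
    have "\<not> R q (g' n t)" for n t
      using trans[OF _ gf(2)[of t0 "t0 + t" "k n"]] nq by (auto simp: g'_def)
    then have "range (g' n) \<subseteq> {x \<in> S. \<not> R q x}" for n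
      using gf(1) by (auto simp: g'_def)
    moreover have "t \<le> u \<Longrightarrow> R (g' n u) (g' n t)" for n t u
      using gf(2) by (simp add: g'_def)
    ultimately have "\<exists>i j. i < j \<and> (\<forall>t. R (g' i t) (g' j t))"
      by (rule antitone_goodD[OF residual[OF \<open>q \<in> S\<close>]])
    then obtain i j where ij: "i < j" "\<And>t. R (g' i t) (g' j t)"
      by auto
    have "R (g (k i) t) (g (k j) t)" for t
      using k(2)[of t i j] ij(1) ij(2)[of "t - t0"] by (cases "t < t0") (auto simp: g'_def)
    moreover have "h (Suc (enumerate M (k i))) < h (Suc (enumerate M (k j)))"
      using ij(1) k(1) M h(1) by (simp add: strict_mono_less enumerate_mono)
    ultimately show False
      using bad unfolding g_def by blast
  qed
qed

lemma wqo_on_imp_antitone_good: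
  fixes R :: "'q \<Rightarrow> 'q \<Rightarrow> bool"
  assumes wqo: "wqo_on R S" and tr: "transp R"
  shows "antitone_good R S"
proof (rule ccontr)
  assume bad: "\<not> ?thesis"
  \<comment> \<open>A state consists of the elements still allowed and of the element
    \<open>q\<close> whose up-set is excluded next. No later choice is above an earlier one, so the
    choices form a bad sequence.\<close>
  define P :: "'q set \<times> 'q \<Rightarrow> bool" where
    "P = (\<lambda>(T, q). T \<subseteq> S \<and> q \<in> T \<and> \<not> antitone_good R {x \<in> T. \<not> R q x})"
  define Q :: "'q set \<times> 'q \<Rightarrow> 'q set \<times> 'q \<Rightarrow> bool" where
    "Q = (\<lambda>(T, q) (T', q'). T' = {x \<in> T. \<not> R q x})"
  have ex: "\<exists>q. P (T, q)" if "T \<subseteq> S" "\<not> antitone_good R T" for T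
    using antitone_good_step[OF wqo_on_subset[OF wqo that(1)] tr] that by (auto simp: P_def)
  have "\<exists>X :: nat \<Rightarrow> 'q set \<times> 'q. \<forall>n. P (X n) \<and> Q (X n) (X (Suc n))"
  proof (rule dependent_nat_choice[of "\<lambda>_. P" "\<lambda>_. Q"])
    show "\<exists>x. P x"
      using ex[of S] bad by blast
    fix x assume "P x"
    then obtain T q where x: "x = (T, q)" and "{y \<in> T. \<not> R q y} \<subseteq> S"
      "\<not> antitone_good R {y \<in> T. \<not> R q y}"
      by (cases x) (auto simp: P_def)
    with ex obtain q' where "P ({y \<in> T. \<not> R q y}, q')"
      by blast
    then show "\<exists>y. P y \<and> Q x y"
      by (intro exI[of _ "({y \<in> T. \<not> R q y}, q')"]) (simp add: x Q_def)
  qed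
  then obtain X where "\<forall>n. P (X n) \<and> Q (X n) (X (Suc n))" ..
  then have PX: "\<And>n. P (X n)" and QX: "\<And>n. Q (X n) (X (Suc n))"
    by simp_all
  have X: "fst (X n) \<subseteq> S" "snd (X n) \<in> fst (X n)"
    "fst (X (Suc n)) = {x \<in> fst (X n). \<not> R (snd (X n)) x}" for n
    using PX[of n] QX[of n] by (auto simp: P_def Q_def split: prod.splits)
  have dec: "fst (X j) \<subseteq> fst (X (Suc i))" if "i < j" for i j
    using that
  proof (induction j)
    case (Suc j)
    then show ?case
      using X(3)[of j] by (cases "i = j") auto
  qed simp
  have "range (snd \<circ> X) \<subseteq> S"
    using X(1,2) by auto
  from wqo_onD[OF wqo this] obtain i j where "i < j" "R (snd (X i)) (snd (X j))"
    by auto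
  with dec[of i j] X(2)[of j] X(3)[of i] show False
    by auto
qed

section \<open>Monomial ideals\<close>

text \<open>Monomials are encoded as multisets of variables, so that divisibility is \<open>\<subseteq>#\<close>. A set of
  monomials stands for the monomial ideal it generates, and \<open>dominates\<close> is reverse inclusion of
  ideals.\<close>

definition msets :: "'c set \<Rightarrow> 'c multiset set" where
  "msets C = {\<alpha>. set_mset \<alpha> \<subseteq> C}"

definition dominates :: "'c multiset set \<Rightarrow> 'c multiset set \<Rightarrow> bool" where
  "dominates A B \<longleftrightarrow> (\<forall>\<beta>\<in>B. \<exists>\<alpha>\<in>A. \<alpha> \<subseteq># \<beta>)"

lemma msets_add [simp]: "\<alpha> + \<beta> \<in> msets C \<longleftrightarrow> \<alpha> \<in> msets C \<and> \<beta> \<in> msets C"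
  by (auto simp: msets_def)

lemma msets_submset: "\<alpha> \<subseteq># \<beta> \<Longrightarrow> \<beta> \<in> msets C \<Longrightarrow> \<alpha> \<in> msets C"
  unfolding msets_def using set_mset_mono by fastforce

lemma transp_dominates: "transp dominates"
  unfolding transp_def dominates_def by (meson subset_mset.order_trans)

text \<open>Maclagan's theorem on antichains of monomial ideals: slice an ideal by the exponent of one
  variable and use that the slices form an increasing sequence of ideals.\<close>

theorem wqo_on_dominates:
  assumes "finite C"
  shows "wqo_on dominates (Pow (msets C))"
  using assms
proof (induction C rule: finite_induct)
  case empty
  show ?case
    unfolding wqo_on_def
  proof (intro allI impI)
    fix A :: "nat \<Rightarrow> 'a multiset set" assume "range A \<subseteq> Pow (msets {})"
    then have "A n \<subseteq> {{#}}" for n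
      by (auto simp: msets_def)
    \<comment> \<open>The zero ideal is dominated by everything and the unit ideal dominates
      everything, so the term with index 1 compares with its predecessor or with its
      successor.\<close>
    then consider "A 1 = {}" | "A 1 = {{#}}"
      by (metis subset_singletonD)
    then show "\<exists>i j. i < j \<and> dominates (A i) (A j)"
    proof cases
      case 1
      then show ?thesis
        by (intro exI[of _ 0] exI[of _ 1]) (simp add: dominates_def)
    next
      case 2
      then show ?thesis
        by (intro exI[of _ 1] exI[of _ 2]) (simp add: dominates_def)
    qed
  qed
next
  case (insert c C)
  show ?case
    unfolding wqo_on_def
  proof (intro allI impI)
    fix A :: "nat \<Rightarrow> 'a multiset set" assume A: "range A \<subseteq> Pow (msets (insert c C))"
    define f where "f n t = {\<beta> \<in> msets C. \<exists>\<alpha>\<in>A n. \<alpha> \<subseteq># \<beta> + replicate_mset t c}" for n t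
    have rep: "\<beta> + replicate_mset t c \<subseteq># \<beta> + replicate_mset u c" if "t \<le> u" for \<beta> t u
      using that by (simp add: subseteq_mset_def)
    have "f n t \<subseteq> f n u" if "t \<le> u" for n t u
      using rep[OF that] unfolding f_def by (blast intro: subset_mset.order_trans)
    \<comment> \<open>Slices grow with the exponent of \<open>c\<close>; for reverse inclusion this
      means antitone.\<close>
    then have "dominates (f n u) (f n t)" if "t \<le> u" for n t u
      using that unfolding dominates_def by blast
    moreover have "range (f n) \<subseteq> Pow (msets C)" for n
      by (auto simp: f_def)
    ultimately have "\<exists>i j. i < j \<and> (\<forall>t. dominates (f i t) (f j t))"
      by (rule antitone_goodD[OF wqo_on_imp_antitone_good[OF insert.IH transp_dominates], rotated])
    then obtain i j where ij: "i < j" "\<And>t. dominates (f i t) (f j t)"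
      by auto
    have "\<exists>\<alpha>\<in>A i. \<alpha> \<subseteq># \<beta>" if \<beta>: "\<beta> \<in> A j" for \<beta>
    proof -
      define \<gamma> where "\<gamma> = filter_mset (\<lambda>x. x \<noteq> c) \<beta>"
      define t where "t = count \<beta> c"
      have eq: "\<beta> = \<gamma> + replicate_mset t c"
        by (rule multiset_eqI) (simp add: \<gamma>_def t_def)
      have "\<beta> \<in> msets (insert c C)"
        using A \<beta> by blast
      then have "\<gamma> \<in> msets C"
        by (auto simp: \<gamma>_def msets_def)
      then have "\<gamma> \<in> f j t"
        using eq \<beta> by (auto simp: f_def)
      then obtain \<delta> where "\<delta> \<in> f i t" "\<delta> \<subseteq># \<gamma>"
        using ij(2) unfolding dominates_def by blast
      then show ?thesis
        unfolding eq f_def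
        by (smt (verit) mem_Collect_eq subset_mset.add_right_mono subset_mset.order_trans)
    qed
    with ij(1) show "\<exists>i j. i < j \<and> dominates (A i) (A j)"
      unfolding dominates_def by blast
  qed
qed

text \<open>The objects in \<open>E\<close> are compared only through the ideals attached to them.
  In the application they are pairs of multidegrees, with one ideal per type of factor.\<close>

lemma finite_basis_monomial_ideals:
  assumes I: "finite I" "\<And>i. i \<in> I \<Longrightarrow> finite (C i)"
    and A: "\<And>i e. i \<in> I \<Longrightarrow> e \<in> E \<Longrightarrow> A i e \<subseteq> msets (C i)"
  shows "\<exists>F. finite F \<and> F \<subseteq> E \<and> (\<forall>e\<in>E. \<exists>f\<in>F. \<forall>i\<in>I. dominates (A i f) (A i e))"
proof (rule finite_basis_of_good[where R = "\<lambda>f e. \<forall>i\<in>I. dominates (A i f) (A i e)"])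
  fix x :: "nat \<Rightarrow> 'c" assume x: "range x \<subseteq> E"
  have "\<exists>h :: nat \<Rightarrow> nat. strict_mono h \<and>
      (\<forall>i\<in>I. \<forall>m n. m < n \<longrightarrow> dominates (A i (x (h m))) (A i (x (h n))))"
  proof (rule wqo_on_common_mono_subseq[where S = "\<lambda>i. Pow (msets (C i))" and x = "\<lambda>i n. A i (x n)"])
    show "wqo_on dominates (Pow (msets (C i)))" if "i \<in> I" for i
      using that I(2) wqo_on_dominates by blast
    show "range (\<lambda>n. A i (x n)) \<subseteq> Pow (msets (C i))" if "i \<in> I" for i
      using that A x by blast
  qed (use I(1) transp_dominates in auto)
  then obtain h :: "nat \<Rightarrow> nat" where h: "strict_mono h"
    "\<forall>i\<in>I. \<forall>m n. m < n \<longrightarrow> dominates (A i (x (h m))) (A i (x (h n)))"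
    by auto
  have "h 0 < h 1"
    using strict_monoD[OF h(1)] by simp
  moreover have "\<forall>i\<in>I. dominates (A i (x (h 0))) (A i (x (h 1)))"
    using h(2) by simp
  ultimately show "\<exists>m n. m < n \<and> (\<forall>i\<in>I. dominates (A i (x m)) (A i (x n)))"
    by blast
qed

text \<open>Dickson's lemma, as the case of a single principal ideal: there \<open>dominates\<close>
  is divisibility.\<close>

lemma finite_basis_monomials:
  assumes C: "finite C" and E: "\<And>e. e \<in> E \<Longrightarrow> \<alpha> e \<in> msets C"
  shows "\<exists>F. finite F \<and> F \<subseteq> E \<and> (\<forall>e\<in>E. \<exists>f\<in>F. \<alpha> f \<subseteq># \<alpha> e)"
  using finite_basis_monomial_ideals[of "{()}" "\<lambda>_. C" E "\<lambda>_ e. {\<alpha> e}"] C E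
  by (simp add: dominates_def)

section \<open>Tables\<close>

text \<open>A monomial of the coordinate ring of a product over \<open>j\<close> of tensor products over \<open>\<Phi>\<close> is a multiset
  of rows \<open>(j, \<mu>)\<close>. Its column at \<open>\<phi> \<in> \<Phi>\<close> is the monomial in the coordinates of the \<open>\<phi>\<close>-th factor that
  it induces, and \<open>image_mset fst\<close> is its multidegree.\<close>

definition column :: "'f \<Rightarrow> ('j \<times> ('f \<Rightarrow> 'l)) multiset \<Rightarrow> ('j \<times> 'l) multiset" where
  "column \<phi> m = image_mset (\<lambda>(j, \<mu>). (j, \<mu> \<phi>)) m"

definition table_rows :: "'f set \<Rightarrow> 'j set \<Rightarrow> ('f \<Rightarrow> ('j \<times> 'l) set) \<Rightarrow> ('j \<times> ('f \<Rightarrow> 'l)) set" where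
  "table_rows \<Phi> J C = {(j, \<mu>). j \<in> J \<and> \<mu> \<in> extensional \<Phi> \<and> (\<forall>\<phi>\<in>\<Phi>. (j, \<mu> \<phi>) \<in> C \<phi>)}"

lemma column_empty [simp]: "column \<phi> {#} = {#}"
  by (simp add: column_def)

lemma column_add [simp]: "column \<phi> (m + m') = column \<phi> m + column \<phi> m'"
  by (simp add: column_def)

lemma column_add_mset [simp]: "column \<phi> (add_mset (j, \<mu>) m) = add_mset (j, \<mu> \<phi>) (column \<phi> m)"
  by (simp add: column_def)

lemma image_fst_column [simp]: "image_mset fst (column \<phi> m) = image_mset fst m"
  by (simp add: column_def image_mset.compositionality comp_def case_prod_unfold)

lemma size_column [simp]: "size (column \<phi> m) = size m"
  by (simp add: column_def)

lemma column_in_msets: "m \<in> msets (table_rows \<Phi> J C) \<Longrightarrow> \<phi> \<in> \<Phi> \<Longrightarrow> column \<phi> m \<in> msets (C \<phi>)"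
  by (auto simp: msets_def table_rows_def column_def)

lemma image_fst_in_msets: "m \<in> msets (table_rows \<Phi> J C) \<Longrightarrow> image_mset fst m \<in> msets J"
  by (auto simp: msets_def table_rows_def)

text \<open>A matching of entries with equal labels. It is used to attach a new column to the rows
  of a table.\<close>

lemma image_mset_eq_pairing:
  assumes "image_mset f A = image_mset g B"
  shows "\<exists>Z. image_mset fst Z = A \<and> image_mset snd Z = B \<and> (\<forall>(x, y)\<in>#Z. f x = g y)"
  using assms
proof (induction A arbitrary: B)
  case empty
  then show ?case
    by (intro exI[of _ "{#}"]) simp
next
  case (add a A)
  then have "f a \<in># image_mset g B"
    by (metis image_mset_add_mset union_single_eq_member)
  then obtain b B' where b: "f a = g b" "B = add_mset b B'"
    by (metis imageE mset_add set_image_mset)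
  with add.prems have "image_mset f A = image_mset g B'"
    by simp
  with add.IH obtain Z where "image_mset fst Z = A" "image_mset snd Z = B'" "\<forall>(x, y)\<in>#Z. f x = g y"
    by blast
  with b show ?case
    by (intro exI[of _ "add_mset (a, b) Z"]) simp
qed

text \<open>Columns are attached one at a time: the entries of the new column are matched with the
  rows that have the same \<open>j\<close>. The equal multidegrees are exactly what makes the
  matching possible.\<close>

lemma ex_table_with_columns:
  assumes "finite \<Phi>" and e: "e \<in> msets J"
    and "\<And>\<phi>. \<phi> \<in> \<Phi> \<Longrightarrow> \<gamma> \<phi> \<in> msets (C \<phi>)" "\<And>\<phi>. \<phi> \<in> \<Phi> \<Longrightarrow> image_mset fst (\<gamma> \<phi>) = e"
  shows "\<exists>m\<in>msets (table_rows \<Phi> J C). image_mset fst m = e \<and> (\<forall>\<phi>\<in>\<Phi>. column \<phi> m = \<gamma> \<phi>)"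
  using assms(1,3,4)
proof (induction \<Phi> rule: finite_induct)
  case empty
  \<comment> \<open>Without factors, a row is \<open>j\<close> together with the only extensional
    function on the empty set.\<close>
  have "image_mset (\<lambda>j. (j, \<lambda>_. undefined)) e \<in> msets (table_rows {} J C)"
    using e by (auto simp: msets_def table_rows_def)
  then show ?case
    by (intro bexI[of _ "image_mset (\<lambda>j. (j, \<lambda>_. undefined)) e"])
      (simp_all add: image_mset.compositionality comp_def)
next
  case (insert \<psi> \<Phi>)
  then obtain m where m: "m \<in> msets (table_rows \<Phi> J C)" "image_mset fst m = e"
    "\<And>\<phi>. \<phi> \<in> \<Phi> \<Longrightarrow> column \<phi> m = \<gamma> \<phi>"
    by (metis insertI2)
  have "image_mset fst m = image_mset fst (\<gamma> \<psi>)"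
    using m(2) insert.prems by simp
  from image_mset_eq_pairing[OF this] obtain Z where Z: "image_mset fst Z = m"
    "image_mset snd Z = \<gamma> \<psi>" "\<And>x y. (x, y) \<in># Z \<Longrightarrow> fst x = fst y"
    by fast
  define m' where "m' = image_mset (\<lambda>(x, y). (fst x, (snd x)(\<psi> := snd y))) Z"
  have "column \<psi> m' = image_mset snd Z"
    unfolding m'_def column_def image_mset.compositionality
    by (rule image_mset_cong) (auto dest: Z(3))
  moreover have "column \<phi> m' = column \<phi> m" if "\<phi> \<in> \<Phi>" for \<phi>
    using that insert.hyps unfolding m'_def column_def Z(1)[symmetric] image_mset.compositionality
    by (intro image_mset_cong) auto
  moreover have "image_mset fst m' = e"
    unfolding m'_def m(2)[symmetric] Z(1)[symmetric] image_mset.compositionality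
    by (intro image_mset_cong) auto
  moreover have "m' \<in> msets (table_rows (insert \<psi> \<Phi>) J C)"
    unfolding msets_def
  proof safe
    fix j \<mu> assume "(j, \<mu>) \<in># m'"
    then obtain x y where xy: "(x, y) \<in># Z" "j = fst x" "\<mu> = (snd x)(\<psi> := snd y)"
      by (auto simp: m'_def)
    have "x \<in># m" "y \<in># \<gamma> \<psi>"
      unfolding Z(1,2)[symmetric] using xy(1) by force+
    then have "x \<in> table_rows \<Phi> J C" "y \<in> C \<psi>"
      using m(1) insert.prems(1)[of \<psi>] by (auto simp: msets_def)
    with xy Z(3)[OF xy(1)] insert.hyps show "(j, \<mu>) \<in> table_rows (insert \<psi> \<Phi>) J C"
      by (cases x, cases y) (auto simp: table_rows_def extensional_def)
  qed
  ultimately show ?case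
    using m Z(2) by (intro bexI[of _ m']) auto
qed

text \<open>\<open>E m m'\<close> abstracts ``\<open>m - m'\<close> lies in the ideal generated by the
  vanishing polynomials of degree at most \<open>D\<close>''.
  The relations \<open>R \<phi>\<close> express equality of monomials as functions on the \<open>\<phi>\<close>-th factor.\<close>

locale table_moves =
  fixes \<Phi> :: "'f set" and J :: "'j::wellorder set" and C :: "'f \<Rightarrow> ('j \<times> 'l::wellorder) set"
    and R :: "'f \<Rightarrow> ('j \<times> 'l) multiset \<Rightarrow> ('j \<times> 'l) multiset \<Rightarrow> bool"
    and E :: "('j \<times> ('f \<Rightarrow> 'l)) multiset \<Rightarrow> ('j \<times> ('f \<Rightarrow> 'l)) multiset \<Rightarrow> bool"
    and D :: nat
  assumes finite_\<Phi>: "finite \<Phi>"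
    and R_refl: "R \<phi> \<alpha> \<alpha>"
    and R_sym: "R \<phi> \<alpha> \<beta> \<Longrightarrow> R \<phi> \<beta> \<alpha>"
    and R_trans: "R \<phi> \<alpha> \<beta> \<Longrightarrow> R \<phi> \<beta> \<gamma> \<Longrightarrow> R \<phi> \<alpha> \<gamma>"
    and R_add: "R \<phi> \<alpha> \<beta> \<Longrightarrow> R \<phi> (\<gamma> + \<alpha>) (\<gamma> + \<beta>)"
    and E_sym: "E m m' \<Longrightarrow> E m' m"
    and E_trans: "E m m' \<Longrightarrow> E m' m'' \<Longrightarrow> E m m''"
    and E_add: "E m m' \<Longrightarrow> u \<in> msets (table_rows \<Phi> J C) \<Longrightarrow> E (u + m) (u + m')"
    and E_small: "m \<in> msets (table_rows \<Phi> J C) \<Longrightarrow> m' \<in> msets (table_rows \<Phi> J C) \<Longrightarrow>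
      size m \<le> D \<Longrightarrow> size m' \<le> D \<Longrightarrow> (\<And>\<phi>. \<phi> \<in> \<Phi> \<Longrightarrow> R \<phi> (column \<phi> m) (column \<phi> m')) \<Longrightarrow> E m m'"
    and D_ge_2: "2 \<le> D"
    and column_step: "\<phi> \<in> \<Phi> \<Longrightarrow> \<alpha> \<in> msets (C \<phi>) \<Longrightarrow> \<beta> \<in> msets (C \<phi>) \<Longrightarrow> R \<phi> \<alpha> \<beta> \<Longrightarrow>
      image_mset fst \<alpha> = image_mset fst \<beta> \<Longrightarrow> \<beta> < \<alpha> \<Longrightarrow>
      \<exists>p q. q \<in> msets (C \<phi>) \<and> p \<subseteq># \<alpha> \<and> R \<phi> p q \<and> image_mset fst p = image_mset fst q \<and>
        q < p \<and> size p \<le> D"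
    and degree_step: "e \<in> msets J \<Longrightarrow> e' \<in> msets J \<Longrightarrow> e' < e \<Longrightarrow>
      \<exists>f f'. f \<subseteq># e \<and> f' \<in> msets J \<and> f' < f \<and> size f \<le> D \<and> size f' \<le> D \<and>
        (\<forall>\<phi>\<in>\<Phi>. \<forall>\<alpha>\<in>msets (C \<phi>). \<forall>\<beta>\<in>msets (C \<phi>).
          image_mset fst \<alpha> = e \<longrightarrow> image_mset fst \<beta> = e' \<longrightarrow> R \<phi> \<alpha> \<beta> \<longrightarrow>
          (\<exists>p q. p \<subseteq># \<alpha> \<and> q \<in> msets (C \<phi>) \<and> image_mset fst p = f \<and> image_mset fst q = f' \<and> R \<phi> p q))"
begin

abbreviation tables where "tables \<equiv> msets (table_rows \<Phi> J C)"

lemma E_refl: "m \<in> tables \<Longrightarrow> E m m"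
  using E_small[of "{#}" "{#}"] E_add[of "{#}" "{#}" m] R_refl by (simp add: msets_def)

section \<open>Tables with equal columns\<close>

text \<open>Each step swaps the entries of two rows with the same \<open>j\<close> in one column.\<close>

lemma swap_to_row:
  assumes m: "m \<in> tables" and j: "j \<in># image_mset fst m"
    and \<mu>: "\<And>\<phi>. \<phi> \<in> \<Phi> \<Longrightarrow> (j, \<mu> \<phi>) \<in># column \<phi> m"
    and "finite \<Psi>" "\<Psi> \<subseteq> \<Phi>"
  shows "\<exists>m1\<in>tables. E m m1 \<and> (\<forall>\<phi>\<in>\<Phi>. column \<phi> m1 = column \<phi> m) \<and>
    image_mset fst m1 = image_mset fst m \<and> (\<exists>\<nu>. (j, \<nu>) \<in># m1 \<and> (\<forall>\<psi>\<in>\<Psi>. \<nu> \<psi> = \<mu> \<psi>))"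
  using assms(4,5)
proof (induction \<Psi> rule: finite_induct)
  case empty
  with m j E_refl show ?case
    by (intro bexI[of _ m]) auto
next
  case (insert \<psi> \<Psi>)
  then obtain m1 \<nu> where m1: "m1 \<in> tables" "E m m1" "\<And>\<phi>. \<phi> \<in> \<Phi> \<Longrightarrow> column \<phi> m1 = column \<phi> m"
    "image_mset fst m1 = image_mset fst m" "(j, \<nu>) \<in># m1" "\<And>\<psi>. \<psi> \<in> \<Psi> \<Longrightarrow> \<nu> \<psi> = \<mu> \<psi>"
    by auto
  have \<psi>: "\<psi> \<in> \<Phi>"
    using insert.prems by simp
  show ?case
  proof (cases "\<nu> \<psi> = \<mu> \<psi>")
    case True
    with m1 show ?thesis
      by (intro bexI[of _ m1]) auto
  next
    case False
    have "(j, \<mu> \<psi>) \<in># column \<psi> m1"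
      using \<mu>[OF \<psi>] m1(3)[OF \<psi>] by simp
    then obtain \<kappa> where \<kappa>: "(j, \<kappa>) \<in># m1" "\<kappa> \<psi> = \<mu> \<psi>"
      by (auto simp: column_def)
    obtain u where u: "m1 = add_mset (j, \<nu>) u"
      using m1(5) by (metis mset_add)
    with \<kappa> False have "(j, \<kappa>) \<in># u"
      by auto
    then obtain w where w: "m1 = w + {#(j, \<nu>), (j, \<kappa>)#}"
      using u by (metis add_mset_add_single mset_add union_commute union_mset_add_mset_right)
    define n where "n = {#(j, \<nu>(\<psi> := \<mu> \<psi>)), (j, \<kappa>(\<psi> := \<nu> \<psi>))#}"
    have rows: "(j, \<nu>) \<in> table_rows \<Phi> J C" "(j, \<kappa>) \<in> table_rows \<Phi> J C" "w \<in> tables"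
      using m1(1) by (auto simp: w msets_def)
    have n: "n \<in> tables"
      using rows \<psi> \<kappa>(2) by (auto simp: n_def msets_def table_rows_def extensional_def)
    have col: "column \<phi> n = column \<phi> {#(j, \<nu>), (j, \<kappa>)#}" for \<phi>
      using \<kappa>(2) by (simp add: n_def add_mset_commute)
    \<comment> \<open>The swap has degree 2 and leaves every column unchanged as a multiset.\<close>
    have "E {#(j, \<nu>), (j, \<kappa>)#} n"
    proof (rule E_small)
      show "{#(j, \<nu>), (j, \<kappa>)#} \<in> tables"
        using rows by (simp add: msets_def)
      show "R \<phi> (column \<phi> {#(j, \<nu>), (j, \<kappa>)#}) (column \<phi> n)" for \<phi>
        unfolding col by (rule R_refl)
    qed (use n D_ge_2 in \<open>simp_all add: n_def\<close>)
    then have "E m1 (w + n)"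
      unfolding w using rows(3) by (rule E_add)
    moreover have "column \<phi> (w + n) = column \<phi> m1" for \<phi>
      unfolding w using col by simp
    moreover have "image_mset fst (w + n) = image_mset fst m1"
      by (simp add: w n_def)
    moreover have "\<exists>\<nu>'. (j, \<nu>') \<in># w + n \<and> (\<forall>\<psi>'\<in>insert \<psi> \<Psi>. \<nu>' \<psi>' = \<mu> \<psi>')"
      using m1(6) by (intro exI[of _ "\<nu>(\<psi> := \<mu> \<psi>)"]) (simp add: n_def)
    ultimately show ?thesis
      using m1(2-4) rows(3) n by (intro bexI[of _ "w + n"]) (auto intro: E_trans)
  qed
qed

text \<open>Swaps produce in \<open>m\<close> a row of \<open>m'\<close>; deleting it from both
  tables leaves smaller tables that again have equal columns. The multidegree is a separate
  hypothesis because without factors there is no column to read it from.\<close>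

lemma same_columns:
  assumes "m \<in> tables" "m' \<in> tables" "image_mset fst m = image_mset fst m'"
    and "\<And>\<phi>. \<phi> \<in> \<Phi> \<Longrightarrow> column \<phi> m = column \<phi> m'"
  shows "E m m'"
  using assms
proof (induction m' arbitrary: m)
  case empty
  then show ?case
    using E_refl by simp
next
  case (add x m')
  obtain j \<mu> where x: "x = (j, \<mu>)"
    by fastforce
  have xt: "(j, \<mu>) \<in> table_rows \<Phi> J C" "m' \<in> tables"
    using add.prems(2) by (auto simp: msets_def x)
  have "\<exists>m1\<in>tables. E m m1 \<and> (\<forall>\<phi>\<in>\<Phi>. column \<phi> m1 = column \<phi> m) \<and>
    image_mset fst m1 = image_mset fst m \<and> (\<exists>\<nu>. (j, \<nu>) \<in># m1 \<and> (\<forall>\<psi>\<in>\<Phi>. \<nu> \<psi> = \<mu> \<psi>))"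
    using add.prems finite_\<Phi> by (intro swap_to_row) (simp_all add: x)
  then obtain m1 \<nu> where m1: "m1 \<in> tables" "E m m1" "\<forall>\<phi>\<in>\<Phi>. column \<phi> m1 = column \<phi> m"
    "image_mset fst m1 = image_mset fst m" "(j, \<nu>) \<in># m1" "\<forall>\<psi>\<in>\<Phi>. \<nu> \<psi> = \<mu> \<psi>"
    by auto
  have "(j, \<nu>) \<in> table_rows \<Phi> J C"
    using m1(1,5) by (auto simp: msets_def)
  with xt m1(6) have "\<nu> = \<mu>"
    by (auto simp: table_rows_def intro: extensionalityI)
  with m1(5) obtain u where u: "m1 = add_mset (j, \<mu>) u"
    by (metis mset_add)
  have "E u m'"
  proof (rule add.IH)
    show "u \<in> tables"
      using m1(1) by (simp add: u msets_def)
    show "image_mset fst u = image_mset fst m'"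
      using m1(4) add.prems(3) by (simp add: u x)
    show "column \<phi> u = column \<phi> m'" if "\<phi> \<in> \<Phi>" for \<phi>
      using m1(3)[rule_format, OF that] add.prems(4)[OF that] by (simp add: u x)
  qed (rule xt)
  then have "E ({#(j, \<mu>)#} + u) ({#(j, \<mu>)#} + m')"
    using xt by (intro E_add) (simp_all add: msets_def)
  with m1(2) show ?case
    by (auto simp: u x intro: E_trans)
qed

section \<open>Tables of equal multidegree\<close>

text \<open>The rows that carry the divisor \<open>p\<close> of the column are exchanged for rows
  that carry \<open>q\<close> there and have the same other columns. They exist because
  \<open>p\<close> and \<open>q\<close> have the same multidegree, and the move has degree
  \<open>size p\<close> whatever the other columns contain.\<close>

lemma reduce_column:
  assumes \<phi>: "\<phi> \<in> \<Phi>" and m: "m \<in> tables" and \<beta>: "\<beta> \<in> msets (C \<phi>)" "R \<phi> (column \<phi> m) \<beta>"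
    "image_mset fst \<beta> = image_mset fst m" "\<beta> < column \<phi> m"
  shows "\<exists>m1\<in>tables. E m m1 \<and> image_mset fst m1 = image_mset fst m \<and>
    (\<forall>\<psi>\<in>\<Phi> - {\<phi>}. column \<psi> m1 = column \<psi> m) \<and>
    R \<phi> (column \<phi> m) (column \<phi> m1) \<and> column \<phi> m1 < column \<phi> m"
proof -
  have "\<exists>p q. q \<in> msets (C \<phi>) \<and> p \<subseteq># column \<phi> m \<and> R \<phi> p q \<and>
      image_mset fst p = image_mset fst q \<and> q < p \<and> size p \<le> D"
    using assms column_in_msets[OF m \<phi>] by (intro column_step) simp_all
  then obtain p q where pq: "q \<in> msets (C \<phi>)" "p \<subseteq># column \<phi> m" "R \<phi> p q"
      "image_mset fst p = image_mset fst q" "q < p" "size p \<le> D"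
    by auto
  then obtain p' where "column \<phi> m = p + p'"
    by (metis subset_mset.le_iff_add)
  then obtain P W where PW: "m = P + W" "p = column \<phi> P"
    unfolding column_def by (metis image_mset_eq_plusD)
  have tab: "P \<in> tables" "W \<in> tables"
    using m by (simp_all add: PW)
  define \<gamma> where "\<gamma> \<psi> = (if \<psi> = \<phi> then q else column \<psi> P)" for \<psi>
  have "\<exists>Q\<in>tables. image_mset fst Q = image_mset fst P \<and> (\<forall>\<psi>\<in>\<Phi>. column \<psi> Q = \<gamma> \<psi>)"
    using finite_\<Phi> pq(1) pq(4)[symmetric] image_fst_in_msets[OF tab(1)] column_in_msets[OF tab(1)]
    by (intro ex_table_with_columns) (simp_all add: \<gamma>_def PW)
  then obtain Q where Q: "Q \<in> tables" "image_mset fst Q = image_mset fst P"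
    "\<And>\<psi>. \<psi> \<in> \<Phi> \<Longrightarrow> column \<psi> Q = \<gamma> \<psi>"
    by auto
  have sz: "size Q = size P"
    using Q(2) by (metis size_image_mset)
  have "E P Q"
  proof (rule E_small)
    show "R \<psi> (column \<psi> P) (column \<psi> Q)" if "\<psi> \<in> \<Phi>" for \<psi>
      using Q(3)[OF that] pq(3) R_refl by (simp add: \<gamma>_def PW)
  qed (use tab Q sz pq(6) PW in simp_all)
  then have "E (W + P) (W + Q)"
    using tab(2) by (rule E_add)
  moreover have "column \<phi> Q = q"
    using Q(3)[OF \<phi>] by (simp add: \<gamma>_def)
  moreover have "R \<phi> (column \<phi> W + column \<phi> P) (column \<phi> W + q)"
    using pq(3) by (intro R_add) (simp add: PW)
  moreover have "column \<phi> W + q < column \<phi> W + column \<phi> P"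
    using pq(5) by (simp add: PW)
  ultimately show ?thesis
    using Q tab by (intro bexI[of _ "W + Q"]) (auto simp: PW \<gamma>_def add.commute)
qed

text \<open>A step may take the larger column below the other one, so neither table can be kept as a
  fixed target. Instead the larger column is lowered each time, and the induction runs on the sum of
  both in the well-founded multiset order.\<close>

lemma change_column:
  assumes \<phi>: "\<phi> \<in> \<Phi>" and "m \<in> tables" "m' \<in> tables" "image_mset fst m = image_mset fst m'"
    and "\<And>\<psi>. \<psi> \<in> \<Phi> - {\<phi>} \<Longrightarrow> column \<psi> m = column \<psi> m'" "R \<phi> (column \<phi> m) (column \<phi> m')"
  shows "E m m'"
  using assms(2-)
proof (induction "column \<phi> m + column \<phi> m'" arbitrary: m m' rule: less_induct)
  case less
  \<comment> \<open>Applied to the two tables in either order, so the induction hypothesis enters as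
    the premise \<open>IH\<close>.\<close>
  have descend: "E m m'"
    if lt: "column \<phi> m' < column \<phi> m" and mm: "m \<in> tables" "m' \<in> tables"
      and fst: "image_mset fst m = image_mset fst m'"
      and col: "\<And>\<psi>. \<psi> \<in> \<Phi> - {\<phi>} \<Longrightarrow> column \<psi> m = column \<psi> m'"
      and R: "R \<phi> (column \<phi> m) (column \<phi> m')"
      and IH: "\<And>m1. column \<phi> m1 < column \<phi> m \<Longrightarrow> m1 \<in> tables \<Longrightarrow>
        image_mset fst m1 = image_mset fst m' \<Longrightarrow>
        (\<And>\<psi>. \<psi> \<in> \<Phi> - {\<phi>} \<Longrightarrow> column \<psi> m1 = column \<psi> m') \<Longrightarrow> R \<phi> (column \<phi> m1) (column \<phi> m') \<Longrightarrow> E m1 m'"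
    for m m'
  proof -
    have "\<exists>m1\<in>tables. E m m1 \<and> image_mset fst m1 = image_mset fst m \<and>
      (\<forall>\<psi>\<in>\<Phi> - {\<phi>}. column \<psi> m1 = column \<psi> m) \<and>
      R \<phi> (column \<phi> m) (column \<phi> m1) \<and> column \<phi> m1 < column \<phi> m"
      using lt mm fst R \<phi> by (intro reduce_column[of _ _ "column \<phi> m'"]) (simp_all add: column_in_msets)
    then obtain m1 where m1: "m1 \<in> tables" "E m m1" "image_mset fst m1 = image_mset fst m"
      "\<forall>\<psi>\<in>\<Phi> - {\<phi>}. column \<psi> m1 = column \<psi> m"
      "R \<phi> (column \<phi> m) (column \<phi> m1)" "column \<phi> m1 < column \<phi> m"
      by auto
    have "E m1 m'"
      using m1 fst col R_trans[OF R_sym[OF m1(5)] R] by (intro IH) simp_all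
    with m1(2) show ?thesis
      by (rule E_trans)
  qed
  consider "column \<phi> m = column \<phi> m'" | "column \<phi> m' < column \<phi> m" | "column \<phi> m < column \<phi> m'"
    by (rule linorder_cases) auto
  then show ?case
  proof cases
    case 1
    with less.prems show ?thesis
      by (intro same_columns) auto
  next
    case 2
    then show ?thesis
      by (rule descend) (use less in simp_all)
  next
    case 3
    have "E m' m"
      using 3
    proof (rule descend)
      fix m1 assume m1: "column \<phi> m1 < column \<phi> m'" "m1 \<in> tables"
        "image_mset fst m1 = image_mset fst m"
        "\<And>\<psi>. \<psi> \<in> \<Phi> - {\<phi>} \<Longrightarrow> column \<psi> m1 = column \<psi> m" "R \<phi> (column \<phi> m1) (column \<phi> m)"
      have "E m m1"
        using m1 less.prems R_sym by (intro less.hyps) simp_all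
      then show "E m1 m"
        by (rule E_sym)
    qed (use less.prems R_sym in simp_all)
    then show ?thesis
      by (rule E_sym)
  qed
qed

text \<open>The intermediate table takes one column from \<open>m'\<close> and the others from
  \<open>m\<close>; the common multidegree guarantees that it exists.\<close>

lemma change_columns:
  assumes "finite \<Psi>" "\<Psi> \<subseteq> \<Phi>" and m': "m' \<in> tables"
    and "m \<in> tables" "image_mset fst m = image_mset fst m'"
    and "\<And>\<phi>. \<phi> \<in> \<Phi> - \<Psi> \<Longrightarrow> column \<phi> m = column \<phi> m'"
    and "\<And>\<phi>. \<phi> \<in> \<Psi> \<Longrightarrow> R \<phi> (column \<phi> m) (column \<phi> m')"
  shows "E m m'"
  using assms(1,2,4-)
proof (induction \<Psi> arbitrary: m rule: finite_induct)
  case empty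
  with m' show ?case
    by (intro same_columns) auto
next
  case (insert \<phi> \<Psi>)
  define \<gamma> where "\<gamma> \<psi> = column \<psi> (if \<psi> = \<phi> then m' else m)" for \<psi>
  have "\<exists>m1\<in>tables. image_mset fst m1 = image_mset fst m \<and> (\<forall>\<psi>\<in>\<Phi>. column \<psi> m1 = \<gamma> \<psi>)"
    using finite_\<Phi> insert.prems m'
    by (intro ex_table_with_columns) (auto simp: \<gamma>_def column_in_msets image_fst_in_msets)
  then obtain m1 where m1: "m1 \<in> tables" "image_mset fst m1 = image_mset fst m"
    "\<And>\<psi>. \<psi> \<in> \<Phi> \<Longrightarrow> column \<psi> m1 = \<gamma> \<psi>"
    by auto
  have "E m m1"
    using insert.prems m1 by (intro change_column[of \<phi>]) (simp_all add: \<gamma>_def)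
  moreover have "E m1 m'"
  proof (rule insert.IH)
    show "column \<psi> m1 = column \<psi> m'" if "\<psi> \<in> \<Phi> - \<Psi>" for \<psi>
      using that insert.prems(4)[of \<psi>] m1(3)[of \<psi>] by (simp add: \<gamma>_def)
    show "R \<psi> (column \<psi> m1) (column \<psi> m')" if "\<psi> \<in> \<Psi>" for \<psi>
      using that insert.prems(1) insert.prems(5)[of \<psi>] m1(3)[of \<psi>] R_refl by (auto simp: \<gamma>_def)
  qed (use insert.prems m1 in simp_all)
  ultimately show ?case
    by (rule E_trans)
qed

section \<open>Tables of different multidegree\<close>

text \<open>Every column trades a piece of multidegree \<open>f\<close> for one of multidegree
  \<open>f'\<close> in the same move. The old pieces are glued to a table \<open>P\<close>, the new
  ones to \<open>Q\<close> and the remainders to \<open>W\<close>, so the degree of the move is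
  bounded by the pieces and not by the number of columns.\<close>

lemma reduce_degree:
  assumes m: "m \<in> tables" "m' \<in> tables" and lt: "image_mset fst m' < image_mset fst m"
    and R: "\<And>\<phi>. \<phi> \<in> \<Phi> \<Longrightarrow> R \<phi> (column \<phi> m) (column \<phi> m')"
  shows "\<exists>m1\<in>tables. E m m1 \<and> image_mset fst m1 < image_mset fst m \<and>
    (\<forall>\<phi>\<in>\<Phi>. R \<phi> (column \<phi> m) (column \<phi> m1))"
proof -
  from degree_step[OF image_fst_in_msets[OF m(1)] image_fst_in_msets[OF m(2)] lt]
  obtain f f' where f: "f \<subseteq># image_mset fst m" "f' \<in> msets J" "f' < f" "size f \<le> D" "size f' \<le> D"
    and step: "\<forall>\<phi>\<in>\<Phi>. \<forall>\<alpha>\<in>msets (C \<phi>). \<forall>\<beta>\<in>msets (C \<phi>).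
          image_mset fst \<alpha> = image_mset fst m \<longrightarrow> image_mset fst \<beta> = image_mset fst m' \<longrightarrow> R \<phi> \<alpha> \<beta> \<longrightarrow>
          (\<exists>p q. p \<subseteq># \<alpha> \<and> q \<in> msets (C \<phi>) \<and> image_mset fst p = f \<and> image_mset fst q = f' \<and> R \<phi> p q)"
    by auto
  have "\<exists>p q. p \<subseteq># column \<phi> m \<and> q \<in> msets (C \<phi>) \<and> image_mset fst p = f \<and> image_mset fst q = f' \<and> R \<phi> p q"
    if "\<phi> \<in> \<Phi>" for \<phi>
    using step[rule_format, of \<phi> "column \<phi> m" "column \<phi> m'"] that R m by (simp add: column_in_msets)
  then obtain p q where pq: "\<And>\<phi>. \<phi> \<in> \<Phi> \<Longrightarrow> p \<phi> \<subseteq># column \<phi> m" "\<And>\<phi>. \<phi> \<in> \<Phi> \<Longrightarrow> q \<phi> \<in> msets (C \<phi>)"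
    "\<And>\<phi>. \<phi> \<in> \<Phi> \<Longrightarrow> image_mset fst (p \<phi>) = f" "\<And>\<phi>. \<phi> \<in> \<Phi> \<Longrightarrow> image_mset fst (q \<phi>) = f'"
    "\<And>\<phi>. \<phi> \<in> \<Phi> \<Longrightarrow> R \<phi> (p \<phi>) (q \<phi>)"
    by metis
  have e: "image_mset fst m \<in> msets J"
    using m(1) by (rule image_fst_in_msets)
  have col: "column \<phi> m \<in> msets (C \<phi>)" if "\<phi> \<in> \<Phi>" for \<phi>
    using m(1) that by (rule column_in_msets)
  have "\<exists>P\<in>tables. image_mset fst P = f \<and> (\<forall>\<phi>\<in>\<Phi>. column \<phi> P = p \<phi>)"
    using finite_\<Phi> pq msets_submset[OF f(1) e] msets_submset[OF pq(1) col]
    by (intro ex_table_with_columns) auto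
  then obtain P where P: "P \<in> tables" "image_mset fst P = f" "\<And>\<phi>. \<phi> \<in> \<Phi> \<Longrightarrow> column \<phi> P = p \<phi>"
    by auto
  have "\<exists>Q\<in>tables. image_mset fst Q = f' \<and> (\<forall>\<phi>\<in>\<Phi>. column \<phi> Q = q \<phi>)"
    using finite_\<Phi> pq f(2) by (intro ex_table_with_columns) auto
  then obtain Q where Q: "Q \<in> tables" "image_mset fst Q = f'" "\<And>\<phi>. \<phi> \<in> \<Phi> \<Longrightarrow> column \<phi> Q = q \<phi>"
    by auto
  have "\<exists>W\<in>tables. image_mset fst W = image_mset fst m - f \<and>
      (\<forall>\<phi>\<in>\<Phi>. column \<phi> W = column \<phi> m - p \<phi>)"
  proof (rule ex_table_with_columns)
    show "image_mset fst m - f \<in> msets J"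
      using msets_submset[OF diff_subset_eq_self e] .
    show "column \<phi> m - p \<phi> \<in> msets (C \<phi>)" if "\<phi> \<in> \<Phi>" for \<phi>
      using msets_submset[OF diff_subset_eq_self col[OF that]] .
    show "image_mset fst (column \<phi> m - p \<phi>) = image_mset fst m - f" if "\<phi> \<in> \<Phi>" for \<phi>
      using pq(1,3)[OF that] by (simp add: image_mset_Diff)
  qed (rule finite_\<Phi>)
  then obtain W where W: "W \<in> tables" "image_mset fst W = image_mset fst m - f"
    "\<And>\<phi>. \<phi> \<in> \<Phi> \<Longrightarrow> column \<phi> W = column \<phi> m - p \<phi>"
    by auto
  \<comment> \<open>The pieces \<open>p \<phi>\<close> may sit in different rows of \<open>m\<close>
    for different \<phi>, so \<open>P\<close> need not be a part of \<open>m\<close>. Swaps bring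
    them together first.\<close>
  have "E m (W + P)"
    using m(1) W P f(1) pq(1) by (intro same_columns) simp_all
  moreover have "E P Q"
  proof (rule E_small)
    show "size P \<le> D" "size Q \<le> D"
      using f(4,5) P(2) Q(2) by (metis size_image_mset)+
  qed (use P Q pq(5) in simp_all)
  then have "E (W + P) (W + Q)"
    using W(1) by (rule E_add)
  moreover have "R \<phi> (column \<phi> m) (column \<phi> (W + Q))" if "\<phi> \<in> \<Phi>" for \<phi>
    using R_add[OF pq(5)[OF that], of "column \<phi> W"] W(3)[OF that] Q(3)[OF that] pq(1)[OF that] by simp
  moreover have "image_mset fst (W + Q) < image_mset fst m"
  proof -
    have "image_mset fst m = image_mset fst W + f"
      using W(2) f(1) by simp
    then show ?thesis
      using Q(2) f(3) by simp
  qed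
  ultimately show ?thesis
    using W(1) Q(1) by (intro bexI[of _ "W + Q"]) (auto intro: E_trans)
qed

text \<open>The scheme of \<open>change_column\<close> with multidegrees in place of columns: the
  larger one is lowered, possibly below the smaller one, so the induction again runs on the
  sum.\<close>

theorem moves_connect:
  assumes "m \<in> tables" "m' \<in> tables" "\<And>\<phi>. \<phi> \<in> \<Phi> \<Longrightarrow> R \<phi> (column \<phi> m) (column \<phi> m')"
  shows "E m m'"
  using assms
proof (induction "image_mset fst m + image_mset fst m'" arbitrary: m m' rule: less_induct)
  case less
  consider "image_mset fst m = image_mset fst m'" | "image_mset fst m' < image_mset fst m"
    | "image_mset fst m < image_mset fst m'"
    by (rule linorder_cases) auto
  then show ?case
  proof cases
    case 1
    with less.prems finite_\<Phi> show ?thesis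
      by (intro change_columns[of \<Phi>]) auto
  next
    case 2
    with reduce_degree[of m m'] less.prems obtain m1 where m1: "m1 \<in> tables" "E m m1"
      "image_mset fst m1 < image_mset fst m" "\<And>\<phi>. \<phi> \<in> \<Phi> \<Longrightarrow> R \<phi> (column \<phi> m) (column \<phi> m1)"
      by auto
    have "E m1 m'"
      using m1 less.prems R_trans[OF R_sym[OF m1(4)]] by (intro less.hyps) simp_all
    with m1(2) show ?thesis
      by (rule E_trans)
  next
    case 3
    have "R \<phi> (column \<phi> m') (column \<phi> m)" if "\<phi> \<in> \<Phi>" for \<phi>
      using less.prems(3)[OF that] by (rule R_sym)
    with 3 reduce_degree[of m' m] less.prems obtain m1 where m1: "m1 \<in> tables" "E m' m1"
      "image_mset fst m1 < image_mset fst m'" "\<And>\<phi>. \<phi> \<in> \<Phi> \<Longrightarrow> R \<phi> (column \<phi> m') (column \<phi> m1)"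
      by auto
    have "E m m1"
      using m1 less.prems by (intro less.hyps) (auto intro: R_trans)
    with E_sym[OF m1(2)] show ?thesis
      by (rule E_trans[rotated])
  qed
qed

end

section \<open>Evaluation of polynomials\<close>

text \<open>The bridge from multisets, which carry the columns, divisibility and the well-order, to
  the exponent vectors of \<open>mpoly\<close>.\<close>

definition mset_monom :: "'c multiset \<Rightarrow> 'c \<Rightarrow>\<^sub>0 nat" where
  "mset_monom \<alpha> = (\<Sum>c\<in>#\<alpha>. Poly_Mapping.single c 1)"

definition mset_eval :: "('c \<Rightarrow> 'k::field) \<Rightarrow> 'c multiset \<Rightarrow> 'k" where
  "mset_eval x \<alpha> = (\<Prod>c\<in>#\<alpha>. x c)"

abbreviation monom_poly :: "'c multiset \<Rightarrow> ('c, 'k::field) mpoly" where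
  "monom_poly \<alpha> \<equiv> Poly_Mapping.single (mset_monom \<alpha>) 1"

lemma mset_eval_empty [simp]: "mset_eval x {#} = 1"
  by (simp add: mset_eval_def)

lemma mset_eval_add_mset [simp]: "mset_eval x (add_mset c \<alpha>) = x c * mset_eval x \<alpha>"
  by (simp add: mset_eval_def)

lemma mset_eval_add [simp]: "mset_eval x (\<alpha> + \<beta>) = mset_eval x \<alpha> * mset_eval x \<beta>"
  by (simp add: mset_eval_def)

lemma mset_monom_add: "mset_monom (\<alpha> + \<beta>) = mset_monom \<alpha> + mset_monom \<beta>"
  by (simp add: mset_monom_def)

lemma lookup_mset_monom [simp]: "Poly_Mapping.lookup (mset_monom \<alpha>) c = count \<alpha> c"
  by (induction \<alpha>) (simp_all add: mset_monom_def lookup_add lookup_single when_def)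

lemma keys_mset_monom [simp]: "Poly_Mapping.keys (mset_monom \<alpha>) = set_mset \<alpha>"
  by (auto simp: in_keys_iff)

lemma mset_monom_inject [simp]: "mset_monom \<alpha> = mset_monom \<beta> \<longleftrightarrow> \<alpha> = \<beta>"
  by (metis lookup_mset_monom multiset_eqI)

lemma mset_monom_surj: obtains \<alpha> where "u = mset_monom \<alpha>"
proof -
  have "finite {c. 0 < Poly_Mapping.lookup u c}"
    using finite_lookup[of u] by simp
  then have "u = mset_monom (Abs_multiset (Poly_Mapping.lookup u))"
    by (intro poly_mapping_eqI) (simp add: Abs_multiset_inverse)
  then show ?thesis
    by (rule that)
qed

lemma monom_deg_mset_monom: "monom_deg (mset_monom \<alpha>) = size \<alpha>"
  by (simp add: monom_deg_def size_multiset_overloaded_eq)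

text \<open>Allows polynomials with different supports to be evaluated over a common index
  set.\<close>

lemma poly_eval_superset:
  assumes "finite U" "Poly_Mapping.keys p \<subseteq> U"
  shows "poly_eval p x =
    (\<Sum>m\<in>U. Poly_Mapping.lookup p m * (\<Prod>c\<in>Poly_Mapping.keys m. x c ^ Poly_Mapping.lookup m c))"
  unfolding poly_eval_def using assms by (intro sum.mono_neutral_left) (auto simp: in_keys_iff)

lemma poly_eval_zero [simp]: "poly_eval 0 x = 0"
  by (simp add: poly_eval_def)

lemma poly_eval_add [simp]: "poly_eval (p + q) x = poly_eval p x + poly_eval q x"
proof -
  let ?U = "Poly_Mapping.keys p \<union> Poly_Mapping.keys q"
  have "Poly_Mapping.keys (p + q) \<subseteq> ?U"
    by (rule keys_add)
  then show ?thesis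
    by (simp add: poly_eval_superset[of ?U] lookup_add distrib_right sum.distrib)
qed

lemma poly_eval_uminus [simp]: "poly_eval (- p) x = - poly_eval p x"
  using poly_eval_add[of p "- p" x] by (simp add: eq_neg_iff_add_eq_0 add.commute)

lemma poly_eval_diff [simp]: "poly_eval (p - q) x = poly_eval p x - poly_eval q x"
  using poly_eval_add[of p "- q" x] by simp

lemma poly_eval_sum: "poly_eval (\<Sum>i\<in>I. p i) x = (\<Sum>i\<in>I. poly_eval (p i) x)"
  by (induction I rule: infinite_finite_induct) simp_all

lemma poly_eval_single [simp]:
  "poly_eval (Poly_Mapping.single (mset_monom \<alpha>) c) x = c * mset_eval x \<alpha>"
proof -
  have "mset_eval x \<alpha> = (\<Prod>c\<in>set_mset \<alpha>. x c ^ count \<alpha> c)"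
    by (simp add: mset_eval_def image_prod_mset_multiplicity)
  then show ?thesis
    by (simp add: poly_eval_superset[of "{mset_monom \<alpha>}"])
qed

lemma poly_mapping_eq_sum_single:
  "p = (\<Sum>u\<in>Poly_Mapping.keys p. Poly_Mapping.single u (Poly_Mapping.lookup p u))"
  by (rule poly_mapping_eqI) (simp add: lookup_sum lookup_single when_def in_keys_iff)

lemma poly_eval_mult [simp]: "poly_eval (p * q) x = poly_eval p x * poly_eval q x"
proof -
  have single: "poly_eval (Poly_Mapping.single u a * Poly_Mapping.single v b) x =
    poly_eval (Poly_Mapping.single u a) x * poly_eval (Poly_Mapping.single v b) x" for u v a b
  proof -
    obtain \<alpha> \<beta> where "u = mset_monom \<alpha>" "v = mset_monom \<beta>"
      by (metis mset_monom_surj)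
    then show ?thesis
      by (simp add: mult_single mset_monom_add[symmetric])
  qed
  let ?t = "\<lambda>p u. Poly_Mapping.single u (Poly_Mapping.lookup p u)"
  have "poly_eval ((\<Sum>u\<in>Poly_Mapping.keys p. ?t p u) * (\<Sum>v\<in>Poly_Mapping.keys q. ?t q v)) x =
    poly_eval (\<Sum>u\<in>Poly_Mapping.keys p. ?t p u) x * poly_eval (\<Sum>v\<in>Poly_Mapping.keys q. ?t q v) x"
    by (simp only: sum_product poly_eval_sum single)
  then show ?thesis
    by (simp only: poly_mapping_eq_sum_single[symmetric])
qed

lemma monom_poly_in_polys: "\<alpha> \<in> msets B \<Longrightarrow> Poly_Mapping.single (mset_monom \<alpha>) c \<in> polys B"
  by (auto simp: polys_def msets_def split: if_splits)

lemma polys_diff: "p \<in> polys B \<Longrightarrow> q \<in> polys B \<Longrightarrow> p - q \<in> polys B"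
  using polys_closed(3)[of p B "- q"] polys_closed(5)[of q B] by simp

section \<open>Vanishing ideals of Hadamard-closed sets\<close>

lemma vanishing_ideal_ideal: "ideal (vanishing_ideal B S) (poly_ring B)"
proof -
  interpret cring "poly_ring B"
    by (rule poly_ring_cring)
  show ?thesis
  proof (rule idealI)
    have inv: "\<ominus>\<^bsub>poly_ring B\<^esub> p = - p" if "p \<in> polys B" for p
      using that by (intro minus_equality) (simp_all add: poly_ring_def polys_closed)
    show "subgroup (vanishing_ideal B S) (add_monoid (poly_ring B))"
    proof (rule add.subgroupI)
      have "0 \<in> vanishing_ideal B S"
        by (simp add: vanishing_ideal_def polys_closed)
      then show "vanishing_ideal B S \<noteq> {}"
        by blast
      fix p assume "p \<in> vanishing_ideal B S"
      then show "\<ominus>\<^bsub>poly_ring B\<^esub> p \<in> vanishing_ideal B S"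
        by (subst inv) (auto simp: vanishing_ideal_def polys_closed)
    qed (auto simp: vanishing_ideal_def poly_ring_def polys_closed)
  qed (use ring_axioms in \<open>auto simp: vanishing_ideal_def poly_ring_def polys_closed\<close>)
qed

text \<open>The zero set of a polynomial that vanishes on \<open>S\<close> is closed and contains
  \<open>S\<close>, hence it contains the closure.\<close>

lemma vanishing_ideal_hull:
  assumes "S \<subseteq> coord_space B"
  shows "vanishing_ideal B (zariski_closed B hull S) = vanishing_ideal B S"
proof
  show "vanishing_ideal B (zariski_closed B hull S) \<subseteq> vanishing_ideal B S"
    using hull_subset[of S "zariski_closed B"] by (auto simp: vanishing_ideal_def)
  show "vanishing_ideal B S \<subseteq> vanishing_ideal B (zariski_closed B hull S)"
  proof
    fix p assume p: "p \<in> vanishing_ideal B S"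
    let ?Z = "{x \<in> coord_space B. \<forall>q\<in>{p}. poly_eval q x = 0}"
    have "zariski_closed B ?Z"
      using p unfolding zariski_closed_def vanishing_ideal_def by blast
    moreover have "S \<subseteq> ?Z"
      using p assms by (auto simp: vanishing_ideal_def)
    ultimately have "zariski_closed B hull S \<subseteq> ?Z"
      by (intro hull_minimal)
    with p show "p \<in> vanishing_ideal B (zariski_closed B hull S)"
      by (auto simp: vanishing_ideal_def)
  qed
qed

text \<open>Artin's argument: translating a relation by \<open>y\<close> and subtracting
  \<open>\<chi> a y\<close> times the relation removes the term of \<open>a\<close>, and any other
  character differs from that of \<open>a\<close> at some \<open>y\<close>.\<close>

lemma characters_independent:
  fixes \<chi> :: "'i \<Rightarrow> 's \<Rightarrow> 'k::field" and op :: "'s \<Rightarrow> 's \<Rightarrow> 's"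
  assumes "finite M"
    and closed: "\<And>x y. x \<in> S \<Longrightarrow> y \<in> S \<Longrightarrow> op x y \<in> S"
    and one: "e \<in> S"
    and "\<And>m x y. m \<in> M \<Longrightarrow> x \<in> S \<Longrightarrow> y \<in> S \<Longrightarrow> \<chi> m (op x y) = \<chi> m x * \<chi> m y"
    and "\<And>m. m \<in> M \<Longrightarrow> \<chi> m e = 1"
    and "\<And>m m'. m \<in> M \<Longrightarrow> m' \<in> M \<Longrightarrow> m \<noteq> m' \<Longrightarrow> \<exists>x\<in>S. \<chi> m x \<noteq> \<chi> m' x"
    and "\<And>x. x \<in> S \<Longrightarrow> (\<Sum>m\<in>M. c m * \<chi> m x) = 0"
  shows "\<forall>m\<in>M. c m = 0"
  using assms(1,4-)
proof (induction M arbitrary: c rule: finite_induct)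
  case empty
  show ?case
    by simp
next
  case (insert a M)
  have *: "c m * (\<chi> m y - \<chi> a y) = 0" if "m \<in> M" "y \<in> S" for m y
  proof -
    have "(\<Sum>m\<in>M. c m * (\<chi> m y - \<chi> a y) * \<chi> m x) = 0" if "x \<in> S" for x
    proof -
      have "(\<Sum>m\<in>insert a M. c m * \<chi> m (op y x)) - \<chi> a y * (\<Sum>m\<in>insert a M. c m * \<chi> m x) = 0"
        using that \<open>y \<in> S\<close> closed insert.prems(4) by simp
      moreover have "(\<Sum>m\<in>insert a M. c m * \<chi> m (op y x)) - \<chi> a y * (\<Sum>m\<in>insert a M. c m * \<chi> m x) =
          (\<Sum>m\<in>insert a M. c m * (\<chi> m y - \<chi> a y) * \<chi> m x)"
        unfolding sum_distrib_left sum_subtractf[symmetric]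
        by (intro sum.cong refl) (simp add: insert.prems(1) that \<open>y \<in> S\<close> algebra_simps)
      ultimately show ?thesis
        using insert.hyps by simp
    qed
    then have "\<forall>m\<in>M. c m * (\<chi> m y - \<chi> a y) = 0"
      using insert.prems by (intro insert.IH) simp_all
    with \<open>m \<in> M\<close> show ?thesis
      by simp
  qed
  have M: "c m = 0" if m: "m \<in> M" for m
  proof -
    have "m \<noteq> a"
      using that insert.hyps by blast
    then obtain y where "y \<in> S" "\<chi> m y \<noteq> \<chi> a y"
      using insert.prems(3)[of m a] m by auto
    with *[OF m] show ?thesis
      by auto
  qed
  \<comment> \<open>Only the term of \<open>a\<close> is left; it is evaluated at the unit
    \<open>e\<close>.\<close>
  moreover have "c a = 0"
    using insert.prems(4)[OF one] insert.hyps M insert.prems(2)[of a] by simp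
  ultimately show ?case
    by simp
qed

lemma mset_eval_hadamard:
  "\<alpha> \<in> msets B \<Longrightarrow> mset_eval (hadamard B x z) \<alpha> = mset_eval x \<alpha> * mset_eval z \<alpha>"
  by (induction \<alpha>) (simp_all add: msets_def hadamard_def)

text \<open>Monomials restrict to characters of the monoid \<open>S\<close>, so a vanishing polynomial has two terms
  that agree on \<open>S\<close>; subtract a multiple of their difference.\<close>

lemma vanishing_ideal_subset_if_binomials:
  assumes one: "restrict (\<lambda>_. 1) B \<in> S"
    and closed: "\<And>x z. x \<in> S \<Longrightarrow> z \<in> S \<Longrightarrow> hadamard B x z \<in> S"
    and I: "ideal I (poly_ring B)"
    and binomial: "\<And>\<alpha> \<beta>. \<alpha> \<in> msets B \<Longrightarrow> \<beta> \<in> msets B \<Longrightarrow>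
      (\<And>x. x \<in> S \<Longrightarrow> mset_eval x \<alpha> = mset_eval x \<beta>) \<Longrightarrow> monom_poly \<alpha> - monom_poly \<beta> \<in> I"
    and p: "p \<in> vanishing_ideal B S"
  shows "p \<in> I"
  using p
proof (induction "card (Poly_Mapping.keys p)" arbitrary: p rule: less_induct)
  case less
  interpret ideal I "poly_ring B"
    by (rule I)
  show ?case
  proof (cases "p = 0")
    case True
    then show ?thesis
      using additive_subgroup.zero_closed[OF additive_subgroup_axioms] by (simp add: poly_ring_def)
  next
    case False
    define M where "M = {\<alpha>. mset_monom \<alpha> \<in> Poly_Mapping.keys p}"
    have bij: "bij_betw mset_monom M (Poly_Mapping.keys p)"
      unfolding bij_betw_def
    proof
      show "inj_on mset_monom M"
        by (rule inj_onI) simp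
      show "mset_monom ` M = Poly_Mapping.keys p"
      proof
        show "Poly_Mapping.keys p \<subseteq> mset_monom ` M"
        proof
          fix u assume "u \<in> Poly_Mapping.keys p"
          moreover obtain \<alpha> where "u = mset_monom \<alpha>"
            by (rule mset_monom_surj)
          ultimately show "u \<in> mset_monom ` M"
            by (simp add: M_def)
        qed
      qed (auto simp: M_def)
    qed
    then have "finite M"
      using bij_betw_finite[OF bij] by simp
    have p: "p \<in> polys B" "\<And>x. x \<in> S \<Longrightarrow> poly_eval p x = 0"
      using less.prems by (auto simp: vanishing_ideal_def)
    have M: "M \<subseteq> msets B"
    proof
      fix \<alpha> assume "\<alpha> \<in> M"
      then have "Poly_Mapping.keys (mset_monom \<alpha>) \<subseteq> B"
        using p(1) unfolding M_def polys_def by blast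
      then show "\<alpha> \<in> msets B"
        by (simp add: msets_def)
    qed
    define c where "c \<alpha> = Poly_Mapping.lookup p (mset_monom \<alpha>)" for \<alpha>
    have "poly_eval p x = (\<Sum>\<alpha>\<in>M. c \<alpha> * mset_eval x \<alpha>)" for x
    proof -
      have "poly_eval p x = (\<Sum>u\<in>Poly_Mapping.keys p.
          poly_eval (Poly_Mapping.single u (Poly_Mapping.lookup p u)) x)"
        using arg_cong[OF poly_mapping_eq_sum_single[of p], of "\<lambda>p. poly_eval p x"]
        by (simp only: poly_eval_sum)
      also have "\<dots> = (\<Sum>\<alpha>\<in>M. c \<alpha> * mset_eval x \<alpha>)"
        using sum.reindex_bij_betw[OF bij,
            of "\<lambda>u. poly_eval (Poly_Mapping.single u (Poly_Mapping.lookup p u)) x"]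
        by (simp add: c_def)
      finally show ?thesis .
    qed
    with p(2) have sum0: "(\<Sum>\<alpha>\<in>M. c \<alpha> * mset_eval x \<alpha>) = 0" if "x \<in> S" for x
      using that by simp
    have "\<exists>\<alpha>\<in>M. \<exists>\<beta>\<in>M. \<alpha> \<noteq> \<beta> \<and> (\<forall>x\<in>S. mset_eval x \<alpha> = mset_eval x \<beta>)"
    proof (rule ccontr)
      assume "\<not> ?thesis"
      then have distinct: "\<exists>x\<in>S. mset_eval x \<alpha> \<noteq> mset_eval x \<beta>" if "\<alpha> \<in> M" "\<beta> \<in> M" "\<alpha> \<noteq> \<beta>" for \<alpha> \<beta>
        using that by blast
      have one_eval: "mset_eval (restrict (\<lambda>_. 1) B) \<alpha> = 1" if "\<alpha> \<in> msets B" for \<alpha>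
        using that by (induction \<alpha>) (simp_all add: msets_def)
      have "\<forall>\<alpha>\<in>M. c \<alpha> = 0"
        using \<open>finite M\<close> closed one
      proof (rule characters_independent[where \<chi> = "\<lambda>\<alpha> x. mset_eval x \<alpha>"])
        show "mset_eval (hadamard B x z) \<alpha> = mset_eval x \<alpha> * mset_eval z \<alpha>" if "\<alpha> \<in> M" for \<alpha> x z
          using that M by (intro mset_eval_hadamard) blast
        show "mset_eval (restrict (\<lambda>_. 1) B) \<alpha> = 1" if "\<alpha> \<in> M" for \<alpha>
          using that M one_eval by blast
      qed (use distinct sum0 in simp_all)
      then have "M = {}"
        by (auto simp: c_def M_def in_keys_iff)
      then have "Poly_Mapping.keys p = {}"
        using bij by (simp add: bij_betw_def)
      with False show False
        by simp
    qed
    then obtain \<alpha> \<beta> where ab: "\<alpha> \<in> M" "\<beta> \<in> M" "\<alpha> \<noteq> \<beta>"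
      "\<And>x. x \<in> S \<Longrightarrow> mset_eval x \<alpha> = mset_eval x \<beta>"
      by blast
    have tab: "\<alpha> \<in> msets B" "\<beta> \<in> msets B"
      using ab M by auto
    let ?b = "monom_poly \<alpha> - monom_poly \<beta> :: ('a, 'b) mpoly"
    define b where "b = Poly_Mapping.single 0 (c \<alpha>) * ?b"
    have const: "Poly_Mapping.single 0 (c \<alpha>) \<in> polys B"
      by (auto simp: polys_def)
    have "b \<in> I"
      using I_l_closed[OF binomial[OF tab ab(4)], of "Poly_Mapping.single 0 (c \<alpha>)"] const
      by (simp add: poly_ring_def b_def)
    have b_eq: "b = Poly_Mapping.single (mset_monom \<alpha>) (c \<alpha>) - Poly_Mapping.single (mset_monom \<beta>) (c \<alpha>)"
      by (simp add: b_def right_diff_distrib mult_single)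
    \<comment> \<open>The subtraction cancels the term of \<alpha> and creates no new one, since
      \<beta> already occurs in \<open>p\<close>.\<close>
    have keys: "Poly_Mapping.keys (p - b) \<subseteq> Poly_Mapping.keys p - {mset_monom \<alpha>}"
      using ab(1-3) by (auto simp: b_eq in_keys_iff lookup_minus lookup_single when_def c_def M_def
        split: if_splits)
    have "p - b \<in> I"
    proof (rule less.hyps)
      have "Poly_Mapping.keys (p - b) \<subset> Poly_Mapping.keys p"
        using keys ab(1) by (auto simp: M_def)
      then show "card (Poly_Mapping.keys (p - b)) < card (Poly_Mapping.keys p)"
        by (intro psubset_card_mono) simp_all
      show "p - b \<in> vanishing_ideal B S"
        using p ab(4) tab
        by (auto simp: vanishing_ideal_def b_eq intro!: polys_diff monom_poly_in_polys)
    qed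
    then have "(p - b) \<oplus>\<^bsub>poly_ring B\<^esub> b \<in> I"
      using \<open>b \<in> I\<close> by (rule additive_subgroup.a_closed[OF additive_subgroup_axioms])
    then show ?thesis
      by (simp add: poly_ring_def)
  qed
qed

section \<open>Uniform bounds\<close>

lemma finite_bound_nat: "finite F \<Longrightarrow> \<exists>D::nat. \<forall>x\<in>F. g x \<le> D"
  by (metis Max_ge finite_imageI imageI)

text \<open>Dickson's lemma is applied to the larger members of all agreeing pairs. The partner
  \<open>q\<close> comes along with the minimal \<open>p\<close>; it need not divide \<beta>,
  because only \<alpha> is rewritten.\<close>

lemma column_step_bound:
  fixes C :: "('j::wellorder \<times> 'l::wellorder) set"
  assumes "finite C"
  shows "\<exists>D. \<forall>\<alpha>\<in>msets C. \<forall>\<beta>\<in>msets C. R \<alpha> \<beta> \<longrightarrow> image_mset fst \<alpha> = image_mset fst \<beta> \<longrightarrow> \<beta> < \<alpha> \<longrightarrow>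
    (\<exists>p q. q \<in> msets C \<and> p \<subseteq># \<alpha> \<and> R p q \<and> image_mset fst p = image_mset fst q \<and> q < p \<and> size p \<le> D)"
proof -
  define E where "E = {(\<alpha>, \<beta>). \<alpha> \<in> msets C \<and> \<beta> \<in> msets C \<and> R \<alpha> \<beta> \<and>
    image_mset fst \<alpha> = image_mset fst \<beta> \<and> \<beta> < \<alpha>}"
  have "\<exists>F. finite F \<and> F \<subseteq> E \<and> (\<forall>e\<in>E. \<exists>f\<in>F. fst f \<subseteq># fst e)"
    using assms by (rule finite_basis_monomials) (auto simp: E_def)
  then obtain F where F: "finite F" "F \<subseteq> E" "\<And>e. e \<in> E \<Longrightarrow> \<exists>f\<in>F. fst f \<subseteq># fst e"
    by blast
  obtain D where D: "\<And>f. f \<in> F \<Longrightarrow> size (fst f) \<le> D"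
    using finite_bound_nat[OF F(1), of "\<lambda>f. size (fst f)"] by blast
  have "\<exists>p q. q \<in> msets C \<and> p \<subseteq># \<alpha> \<and> R p q \<and> image_mset fst p = image_mset fst q \<and> q < p \<and> size p \<le> D"
    if ab: "(\<alpha>, \<beta>) \<in> E" for \<alpha> \<beta>
  proof -
    obtain g where "g \<in> F" "fst g \<subseteq># \<alpha>"
      using F(3)[OF ab] by auto
    then obtain p q where "(p, q) \<in> F" "p \<subseteq># \<alpha>"
      by (cases g) simp
    with F(2) D show ?thesis
      by (intro exI[of _ p] exI[of _ q]) (auto simp: E_def)
  qed
  then show ?thesis
    by (intro exI[of _ D]) (simp add: E_def)
qed

text \<open>The extra index \<open>s\<close> below makes the divisibility \<open>f \<subseteq># e\<close> part of the comparison of families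
  of monomial ideals; it only matters when there are no factors.\<close>

lemma degree_step_bound:
  fixes C :: "nat \<Rightarrow> ('j::wellorder \<times> nat) set"
  assumes J: "finite J" and C: "\<And>i. i < s \<Longrightarrow> finite (C i)"
  shows "\<exists>D. \<forall>e\<in>msets J. \<forall>e'\<in>msets J. e' < e \<longrightarrow>
    (\<exists>f f'. f \<subseteq># e \<and> f' \<in> msets J \<and> f' < f \<and> size f \<le> D \<and> size f' \<le> D \<and>
      (\<forall>i<s. \<forall>\<alpha>\<in>msets (C i). \<forall>\<beta>\<in>msets (C i).
        image_mset fst \<alpha> = e \<longrightarrow> image_mset fst \<beta> = e' \<longrightarrow> R i \<alpha> \<beta> \<longrightarrow>
        (\<exists>p q. p \<subseteq># \<alpha> \<and> q \<in> msets (C i) \<and> image_mset fst p = f \<and> image_mset fst q = f' \<and> R i p q)))"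
proof -
  define E where "E = {(e, e'). e \<in> msets J \<and> e' \<in> msets J \<and> e' < e}"
  define C' where "C' i = (if i < s then C i else J \<times> {0})" for i
  \<comment> \<open>For \<open>i < s\<close> these are the monomials of multidegree \<open>e\<close>
    that have a partner of multidegree \<open>e'\<close>. Domination finds a divisor
    \<open>p\<close> of \<alpha> in the set for \<open>(f, f')\<close>, and membership there
    supplies the partner \<open>q\<close>, independently of \<beta>. Thus one pair
    \<open>(f, f')\<close> serves all \<alpha> and all \<open>i\<close>.\<close>
  define A where "A i \<epsilon> = (if i < s then {\<alpha> \<in> msets (C i). image_mset fst \<alpha> = fst \<epsilon> \<and>
      (\<exists>\<beta>\<in>msets (C i). image_mset fst \<beta> = snd \<epsilon> \<and> R i \<alpha> \<beta>)}
    else {image_mset (\<lambda>j. (j, 0)) (fst \<epsilon>)})" for i \<epsilon>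
  have "\<exists>F. finite F \<and> F \<subseteq> E \<and> (\<forall>e\<in>E. \<exists>f\<in>F. \<forall>i\<in>{..s}. dominates (A i f) (A i e))"
  proof (rule finite_basis_monomial_ideals)
    show "finite (C' i)" for i
      using J C by (simp add: C'_def)
    show "A i \<epsilon> \<subseteq> msets (C' i)" if "\<epsilon> \<in> E" for i \<epsilon>
      using that by (auto simp: A_def C'_def E_def msets_def)
  qed simp
  then obtain F where F: "finite F" "F \<subseteq> E"
    "\<And>\<epsilon>. \<epsilon> \<in> E \<Longrightarrow> \<exists>f\<in>F. \<forall>i\<in>{..s}. dominates (A i f) (A i \<epsilon>)"
    by blast
  obtain D where D: "\<And>f. f \<in> F \<Longrightarrow> size (fst f) + size (snd f) \<le> D"
    using finite_bound_nat[OF F(1), of "\<lambda>f. size (fst f) + size (snd f)"] by blast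
  show ?thesis
  proof (intro exI[of _ D] ballI impI)
    fix e e' assume "e \<in> msets J" "e' \<in> msets J" "e' < e"
    then have "(e, e') \<in> E"
      by (simp add: E_def)
    from F(3)[OF this] obtain f f' where f: "(f, f') \<in> F"
      and dom: "\<And>i. i \<le> s \<Longrightarrow> dominates (A i (f, f')) (A i (e, e'))"
      by force
    have "image_mset (\<lambda>j. (j, 0::nat)) f \<subseteq># image_mset (\<lambda>j. (j, 0)) e"
      using dom[of s] by (simp add: dominates_def A_def)
    from image_mset_subseteq_mono[OF this, of fst] have "f \<subseteq># e"
      by (simp add: image_mset.compositionality comp_def)
    moreover have "\<exists>p q. p \<subseteq># \<alpha> \<and> q \<in> msets (C i) \<and> image_mset fst p = f \<and> image_mset fst q = f' \<and> R i p q"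
      if "i < s" "\<alpha> \<in> msets (C i)" "\<beta> \<in> msets (C i)" "image_mset fst \<alpha> = e" "image_mset fst \<beta> = e'" "R i \<alpha> \<beta>"
      for i \<alpha> \<beta>
    proof -
      have "\<alpha> \<in> A i (e, e')"
        using that by (auto simp: A_def)
      then obtain p where "p \<in> A i (f, f')" "p \<subseteq># \<alpha>"
        using dom[of i] \<open>i < s\<close> unfolding dominates_def by auto
      then show ?thesis
        using \<open>i < s\<close> by (auto simp: A_def)
    qed
    moreover have "f' \<in> msets J" "f' < f" "size f \<le> D" "size f' \<le> D"
      using f F(2) D[OF f] by (auto simp: E_def)
    ultimately show "\<exists>f f'. f \<subseteq># e \<and> f' \<in> msets J \<and> f' < f \<and> size f \<le> D \<and> size f' \<le> D \<and>
      (\<forall>i<s. \<forall>\<alpha>\<in>msets (C i). \<forall>\<beta>\<in>msets (C i).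
        image_mset fst \<alpha> = e \<longrightarrow> image_mset fst \<beta> = e' \<longrightarrow> R i \<alpha> \<beta> \<longrightarrow>
        (\<exists>p q. p \<subseteq># \<alpha> \<and> q \<in> msets (C i) \<and> image_mset fst p = f \<and> image_mset fst q = f' \<and> R i p q))"
      by (intro exI[of _ f] exI[of _ f']) simp
  qed
qed

section \<open>Generation in bounded degree\<close>

definition pure_tensors ::
    "nat \<Rightarrow> nat \<Rightarrow> (nat \<Rightarrow> nat \<Rightarrow> nat) \<Rightarrow> (nat \<Rightarrow> (nat \<times> nat \<Rightarrow> 'k::field) set) \<Rightarrow> (nat \<Rightarrow> nat)
      \<Rightarrow> (nat \<times> (nat \<times> nat \<Rightarrow> nat) \<Rightarrow> 'k) set" where
  "pure_tensors s r d X a = {pure_tensor s r d a v | v. \<forall>(i, k) \<in> factors s a. v i k \<in> X i}"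

definition agree_on :: "('c \<Rightarrow> 'k::field) set \<Rightarrow> 'c multiset \<Rightarrow> 'c multiset \<Rightarrow> bool" where
  "agree_on S \<alpha> \<beta> \<longleftrightarrow> (\<forall>x\<in>S. mset_eval x \<alpha> = mset_eval x \<beta>)"

lemma finite_factors: "finite (factors s a)"
  by (simp add: factors_def)

lemma finite_prod_coords: "finite (prod_coords r n)"
  by (simp add: prod_coords_def)

lemma tensor_coords_eq_table_rows:
  "tensor_coords s r d a = table_rows (factors s a) {..<r} (\<lambda>(i, k). prod_coords r (d i))"
proof (rule Set.set_eqI)
  fix c :: "nat \<times> (nat \<times> nat \<Rightarrow> nat)"
  obtain j \<mu> where c: "c = (j, \<mu>)"
    by fastforce
  show "c \<in> tensor_coords s r d a \<longleftrightarrow>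
      c \<in> table_rows (factors s a) {..<r} (\<lambda>(i, k). prod_coords r (d i))"
    unfolding c by (cases "j < r")
      (simp_all add: tensor_coords_def table_rows_def prod_coords_def PiE_iff case_prod_unfold conj_commute)
qed

section \<open>Monomials on pure tensors\<close>

text \<open>The product over rows and the product over factors are exchanged; what one factor
  contributes over all rows is the value of its column.\<close>

lemma mset_eval_pure_tensor:
  assumes "m \<in> msets (tensor_coords s r d a)"
  shows "mset_eval (pure_tensor s r d a v) m =
    (\<Prod>(i, k)\<in>factors s a. mset_eval (v i k) (column (i, k) m))"
  using assms
proof (induction m)
  case empty
  show ?case
    by (simp add: case_prod_unfold)
next
  case (add x m)
  obtain j \<mu> where x: "x = (j, \<mu>)"
    by fastforce
  have "(j, \<mu>) \<in> tensor_coords s r d a" "m \<in> msets (tensor_coords s r d a)"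
    using add.prems by (simp_all add: msets_def x)
  then show ?case
    using add.IH by (simp add: x pure_tensor_def case_prod_unfold prod.distrib)
qed

text \<open>Together with \<open>pure_tensor_one\<close> this makes the pure tensors a monoid, so
  that the reduction to binomials applies before the closure is taken.\<close>

lemma hadamard_pure_tensor:
  "hadamard (tensor_coords s r d a) (pure_tensor s r d a v) (pure_tensor s r d a w) =
    pure_tensor s r d a (\<lambda>i k. hadamard (prod_coords r (d i)) (v i k) (w i k))"
proof (rule extensionalityI[of _ "tensor_coords s r d a"])
  fix c assume c: "c \<in> tensor_coords s r d a"
  obtain j \<mu> where jm: "c = (j, \<mu>)"
    by fastforce
  have "(\<Prod>(i, k)\<in>factors s a. v i k (j, \<mu> (i, k))) * (\<Prod>(i, k)\<in>factors s a. w i k (j, \<mu> (i, k))) =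
    (\<Prod>(i, k)\<in>factors s a. hadamard (prod_coords r (d i)) (v i k) (w i k) (j, \<mu> (i, k)))"
    unfolding prod.distrib[symmetric] using c
    by (intro prod.cong refl) (auto simp: jm hadamard_def tensor_coords_eq_table_rows table_rows_def)
  with c show "hadamard (tensor_coords s r d a) (pure_tensor s r d a v) (pure_tensor s r d a w) c =
    pure_tensor s r d a (\<lambda>i k. hadamard (prod_coords r (d i)) (v i k) (w i k)) c"
    by (simp add: jm hadamard_def pure_tensor_def)
qed (simp_all add: hadamard_def pure_tensor_def)

lemma pure_tensor_one:
  "pure_tensor s r d a (\<lambda>i k. restrict (\<lambda>_. 1) (prod_coords r (d i))) =
    restrict (\<lambda>_. 1) (tensor_coords s r d a)"
proof (rule extensionalityI[of _ "tensor_coords s r d a"])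
  fix c assume c: "c \<in> tensor_coords s r d a"
  obtain j \<mu> where jm: "c = (j, \<mu>)"
    by fastforce
  have "(\<Prod>(i, k)\<in>factors s a. restrict (\<lambda>_. 1) (prod_coords r (d i)) (j, \<mu> (i, k))) = (1::'a)"
    using c by (intro prod.neutral) (auto simp: jm tensor_coords_eq_table_rows table_rows_def)
  with c show "pure_tensor s r d a (\<lambda>i k. restrict (\<lambda>_. 1) (prod_coords r (d i))) c =
    (restrict (\<lambda>_. 1) (tensor_coords s r d a) c :: 'a)"
    by (simp add: jm pure_tensor_def)
qed (simp_all add: pure_tensor_def)

text \<open>Agreement of the columns multiplies up to agreement on pure tensors. Conversely, the
  all-one vector in all other factors isolates a single column.\<close>

lemma agree_on_columns:
  assumes one: "\<forall>i<s. restrict (\<lambda>_. 1) (prod_coords r (d i)) \<in> X i"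
    and m: "m \<in> msets (tensor_coords s r d a)" "m' \<in> msets (tensor_coords s r d a)"
  shows "agree_on (pure_tensors s r d X a) m m' \<longleftrightarrow>
    (\<forall>(i, k)\<in>factors s a. agree_on (X i) (column (i, k) m) (column (i, k) m'))"
proof
  assume *: "\<forall>(i, k)\<in>factors s a. agree_on (X i) (column (i, k) m) (column (i, k) m')"
  show "agree_on (pure_tensors s r d X a) m m'"
    unfolding agree_on_def
  proof
    fix x assume "x \<in> pure_tensors s r d X a"
    then obtain v where v: "x = pure_tensor s r d a v" "\<forall>(i, k)\<in>factors s a. v i k \<in> X i"
      unfolding pure_tensors_def by blast
    show "mset_eval x m = mset_eval x m'"
      unfolding v(1) mset_eval_pure_tensor[OF m(1)] mset_eval_pure_tensor[OF m(2)]
      using * v(2) by (intro prod.cong refl) (fastforce simp: agree_on_def)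
  qed
next
  assume *: "agree_on (pure_tensors s r d X a) m m'"
  show "\<forall>(i, k)\<in>factors s a. agree_on (X i) (column (i, k) m) (column (i, k) m')"
  proof safe
    fix i k assume ik: "(i, k) \<in> factors s a"
    show "agree_on (X i) (column (i, k) m) (column (i, k) m')"
      unfolding agree_on_def
    proof
      fix x assume x: "x \<in> X i"
      define v where
        "v i' k' = (if (i', k') = (i, k) then x else restrict (\<lambda>_. 1) (prod_coords r (d i')))" for i' k'
      have eval: "mset_eval (pure_tensor s r d a v) n = mset_eval x (column (i, k) n)"
        if n: "n \<in> msets (tensor_coords s r d a)" for n
      proof -
        have one_eval: "mset_eval (restrict (\<lambda>_. 1) B) \<alpha> = 1" if "\<alpha> \<in> msets B"
          for \<alpha> and B :: "(nat \<times> nat) set"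
          using that by (induction \<alpha>) (simp_all add: msets_def)
        have "(case \<phi> of (i', k') \<Rightarrow> mset_eval (v i' k') (column (i', k') n)) =
            (if \<phi> = (i, k) then mset_eval x (column (i, k) n) else 1)"
          if "\<phi> \<in> factors s a" for \<phi>
          using column_in_msets[OF n[unfolded tensor_coords_eq_table_rows] that]
          by (cases \<phi>) (auto simp: v_def one_eval)
        then have "mset_eval (pure_tensor s r d a v) n =
            (\<Prod>\<phi>\<in>factors s a. if \<phi> = (i, k) then mset_eval x (column (i, k) n) else 1)"
          unfolding mset_eval_pure_tensor[OF n] by (rule prod.cong[OF refl])
        then show ?thesis
          using ik finite_factors by simp
      qed
      have "v i' k' \<in> X i'" if "(i', k') \<in> factors s a" for i' k'
        using that one x by (auto simp: v_def factors_def)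
      then have "pure_tensor s r d a v \<in> pure_tensors s r d X a"
        unfolding pure_tensors_def by blast
      with * show "mset_eval x (column (i, k) m) = mset_eval x (column (i, k) m')"
        unfolding agree_on_def eval[OF m(1), symmetric] eval[OF m(2), symmetric] by blast
    qed
  qed
qed

text \<open>The conditions on \<open>D\<close> mention the types \<open>i < s\<close> but not the
  exponents \<open>a\<close>: all copies of one type have the same coordinates and the same
  agreement relation. So a single \<open>D\<close> works for every \<open>a\<close>.\<close>

lemma vanishing_ideal_pure_tensors_generated:
  fixes X :: "nat \<Rightarrow> (nat \<times> nat \<Rightarrow> 'k::field) set"
  assumes X: "\<And>i. i < s \<Longrightarrow> hadamard_stable (prod_coords r (d i)) (X i)"
    and D: "2 \<le> D"
    and column_step: "\<And>i \<alpha> \<beta>. i < s \<Longrightarrow> \<alpha> \<in> msets (prod_coords r (d i)) \<Longrightarrow>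
      \<beta> \<in> msets (prod_coords r (d i)) \<Longrightarrow> agree_on (X i) \<alpha> \<beta> \<Longrightarrow>
      image_mset fst \<alpha> = image_mset fst \<beta> \<Longrightarrow> \<beta> < \<alpha> \<Longrightarrow>
      \<exists>p q. q \<in> msets (prod_coords r (d i)) \<and> p \<subseteq># \<alpha> \<and> agree_on (X i) p q \<and>
        image_mset fst p = image_mset fst q \<and> q < p \<and> size p \<le> D"
    and degree_step: "\<And>e e'. e \<in> msets {..<r} \<Longrightarrow> e' \<in> msets {..<r} \<Longrightarrow> e' < e \<Longrightarrow>
      \<exists>f f'. f \<subseteq># e \<and> f' \<in> msets {..<r} \<and> f' < f \<and> size f \<le> D \<and> size f' \<le> D \<and>
      (\<forall>i<s. \<forall>\<alpha>\<in>msets (prod_coords r (d i)). \<forall>\<beta>\<in>msets (prod_coords r (d i)).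
        image_mset fst \<alpha> = e \<longrightarrow> image_mset fst \<beta> = e' \<longrightarrow> agree_on (X i) \<alpha> \<beta> \<longrightarrow>
        (\<exists>p q. p \<subseteq># \<alpha> \<and> q \<in> msets (prod_coords r (d i)) \<and> image_mset fst p = f \<and>
          image_mset fst q = f' \<and> agree_on (X i) p q))"
  shows "generated_in_degree_le (tensor_coords s r d a)
    (vanishing_ideal (tensor_coords s r d a) (pure_tensors s r d X a)) D"
proof -
  define B where "B = tensor_coords s r d a"
  define S where "S = pure_tensors s r d X a"
  \<comment> \<open>Taking all vanishing polynomials of bounded degree reduces
    \<open>E_small\<close> to checking agreement and degree of a binomial.\<close>
  define G where "G = {g \<in> vanishing_ideal B S. deg_le g D}"
  define I where "I = Idl\<^bsub>poly_ring B\<^esub> G"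
  define E where "E m m' \<longleftrightarrow> (monom_poly m - monom_poly m' :: (_, 'k) mpoly) \<in> I" for m m'
  interpret P: cring "poly_ring B :: (_, 'k) mpoly ring"
    by (rule poly_ring_cring)
  have G: "G \<subseteq> polys B"
    by (auto simp: G_def vanishing_ideal_def)
  have ideal_I: "ideal I (poly_ring B)"
    using G unfolding I_def by (intro P.genideal_ideal) (simp add: poly_ring_def)
  have GI: "G \<subseteq> I"
    using G unfolding I_def by (intro P.genideal_self) (simp add: poly_ring_def)
  have I_add: "p + q \<in> I" if "p \<in> I" "q \<in> I" for p q
    using additive_subgroup.a_closed[OF ideal.axioms(1)[OF ideal_I] that] by (simp add: poly_ring_def)
  have I_mult: "q * p \<in> I" if "p \<in> I" "q \<in> polys B" for p q
    using ideal.I_l_closed[OF ideal_I that(1), of q] that(2) by (simp add: poly_ring_def)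
  have one: "\<forall>i<s. restrict (\<lambda>_. 1) (prod_coords r (d i)) \<in> X i"
    using X by (simp add: hadamard_stable_def)
  interpret table_moves "factors s a" "{..<r}" "\<lambda>(i, k). prod_coords r (d i)"
    "\<lambda>(i, k). agree_on (X i)" E D
  proof
    show "E m' m" if "E m m'" for m m'
      using I_mult[OF that[unfolded E_def], of "- 1"] by (simp add: E_def polys_closed)
    show "E m m''" if "E m m'" "E m' m''" for m m' m''
      using I_add[OF that[unfolded E_def]] by (simp add: E_def)
    show "E (u + m) (u + m')"
      if "E m m'" "u \<in> msets (table_rows (factors s a) {..<r} (\<lambda>(i, k). prod_coords r (d i)))" for m m' u
    proof -
      have "monom_poly u \<in> (polys B :: (_, 'k) mpoly set)"
        using that(2) unfolding B_def tensor_coords_eq_table_rows by (rule monom_poly_in_polys)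
      from I_mult[OF that(1)[unfolded E_def] this] show ?thesis
        by (simp add: E_def right_diff_distrib mult_single mset_monom_add)
    qed
    show "E m m'"
      if m: "m \<in> msets (table_rows (factors s a) {..<r} (\<lambda>(i, k). prod_coords r (d i)))"
        "m' \<in> msets (table_rows (factors s a) {..<r} (\<lambda>(i, k). prod_coords r (d i)))"
        and size: "size m \<le> D" "size m' \<le> D"
        and R: "\<And>\<phi>. \<phi> \<in> factors s a \<Longrightarrow> (case \<phi> of (i, k) \<Rightarrow> agree_on (X i)) (column \<phi> m) (column \<phi> m')"
      for m m'
    proof -
      note m = m[folded tensor_coords_eq_table_rows]
      have "\<forall>(i, k)\<in>factors s a. agree_on (X i) (column (i, k) m) (column (i, k) m')"
        using R by fastforce
      then have "agree_on S m m'"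
        unfolding S_def by (rule iffD2[OF agree_on_columns[of s r d X, OF one m]])
      moreover have "monom_poly m - monom_poly m' \<in> (polys B :: (_, 'k) mpoly set)"
        using m by (intro polys_diff monom_poly_in_polys) (simp_all add: B_def)
      moreover have "deg_le (monom_poly m - monom_poly m' :: (_, 'k) mpoly) D"
        using size keys_diff[of "monom_poly m :: (_, 'k) mpoly" "monom_poly m'"]
        by (auto simp: deg_le_def monom_deg_mset_monom)
      ultimately have "monom_poly m - monom_poly m' \<in> G"
        by (simp add: G_def vanishing_ideal_def agree_on_def)
      then show ?thesis
        using GI by (auto simp: E_def)
    qed
    show "\<exists>p q. q \<in> msets (case \<phi> of (i, k) \<Rightarrow> prod_coords r (d i)) \<and> p \<subseteq># \<alpha> \<and>
        (case \<phi> of (i, k) \<Rightarrow> agree_on (X i)) p q \<and> image_mset fst p = image_mset fst q \<and> q < p \<and> size p \<le> D"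
      if "\<phi> \<in> factors s a" "\<alpha> \<in> msets (case \<phi> of (i, k) \<Rightarrow> prod_coords r (d i))"
        "\<beta> \<in> msets (case \<phi> of (i, k) \<Rightarrow> prod_coords r (d i))"
        "(case \<phi> of (i, k) \<Rightarrow> agree_on (X i)) \<alpha> \<beta>" "image_mset fst \<alpha> = image_mset fst \<beta>" "\<beta> < \<alpha>"
      for \<phi> \<alpha> \<beta>
      using column_step[of "fst \<phi>" \<alpha> \<beta>] that by (auto simp: factors_def)
    show "\<exists>f f'. f \<subseteq># e \<and> f' \<in> msets {..<r} \<and> f' < f \<and> size f \<le> D \<and> size f' \<le> D \<and>
        (\<forall>\<phi>\<in>factors s a. \<forall>\<alpha>\<in>msets (case \<phi> of (i, k) \<Rightarrow> prod_coords r (d i)).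
          \<forall>\<beta>\<in>msets (case \<phi> of (i, k) \<Rightarrow> prod_coords r (d i)).
          image_mset fst \<alpha> = e \<longrightarrow> image_mset fst \<beta> = e' \<longrightarrow> (case \<phi> of (i, k) \<Rightarrow> agree_on (X i)) \<alpha> \<beta> \<longrightarrow>
          (\<exists>p q. p \<subseteq># \<alpha> \<and> q \<in> msets (case \<phi> of (i, k) \<Rightarrow> prod_coords r (d i)) \<and>
            image_mset fst p = f \<and> image_mset fst q = f' \<and> (case \<phi> of (i, k) \<Rightarrow> agree_on (X i)) p q))"
      if e: "e \<in> msets {..<r}" "e' \<in> msets {..<r}" "e' < e" for e e'
    proof -
      from degree_step[OF e] obtain f f' where
        f: "f \<subseteq># e" "f' \<in> msets {..<r}" "f' < f" "size f \<le> D" "size f' \<le> D" and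
        step: "\<forall>i<s. \<forall>\<alpha>\<in>msets (prod_coords r (d i)). \<forall>\<beta>\<in>msets (prod_coords r (d i)).
          image_mset fst \<alpha> = e \<longrightarrow> image_mset fst \<beta> = e' \<longrightarrow> agree_on (X i) \<alpha> \<beta> \<longrightarrow>
          (\<exists>p q. p \<subseteq># \<alpha> \<and> q \<in> msets (prod_coords r (d i)) \<and> image_mset fst p = f \<and>
            image_mset fst q = f' \<and> agree_on (X i) p q)"
        by auto
      show ?thesis
        by (rule exI[of _ f], rule exI[of _ f'])
          (use f step in \<open>simp add: factors_def case_prod_unfold\<close>)
    qed
  qed (use finite_factors D in \<open>auto simp: agree_on_def\<close>)
  have "p \<in> I" if "p \<in> vanishing_ideal B S" for p
  proof (rule vanishing_ideal_subset_if_binomials[OF _ _ ideal_I _ that])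
    show "restrict (\<lambda>_. 1) B \<in> S"
      unfolding B_def S_def pure_tensors_def pure_tensor_one[symmetric]
      using one by (auto simp: factors_def)
    show "hadamard B x z \<in> S" if "x \<in> S" "z \<in> S" for x z
    proof -
      from that obtain v w where x: "x = pure_tensor s r d a v" "\<forall>(i, k)\<in>factors s a. v i k \<in> X i"
        and z: "z = pure_tensor s r d a w" "\<forall>(i, k)\<in>factors s a. w i k \<in> X i"
        unfolding S_def pure_tensors_def by blast
      have "hadamard (prod_coords r (d i)) (v i k) (w i k) \<in> X i" if "(i, k) \<in> factors s a" for i k
        using that X[of i] x(2) z(2) by (auto simp: hadamard_stable_def factors_def)
      then show ?thesis
        unfolding B_def S_def x(1) z(1) hadamard_pure_tensor pure_tensors_def by blast
    qed
    show "monom_poly \<alpha> - monom_poly \<beta> \<in> I" if "\<alpha> \<in> msets B" "\<beta> \<in> msets B"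
      "\<And>x. x \<in> S \<Longrightarrow> mset_eval x \<alpha> = mset_eval x \<beta>" for \<alpha> \<beta>
    proof -
      have "agree_on S \<alpha> \<beta>"
        using that(3) by (simp add: agree_on_def)
      then have "\<forall>(i, k)\<in>factors s a. agree_on (X i) (column (i, k) \<alpha>) (column (i, k) \<beta>)"
        unfolding S_def agree_on_columns[of s r d X, OF one that(1,2)[unfolded B_def]] .
      then have "E \<alpha> \<beta>"
        using that(1,2) unfolding B_def tensor_coords_eq_table_rows
        by (intro moves_connect) auto
      then show ?thesis
        by (simp add: E_def)
    qed
  qed
  moreover have "I \<subseteq> vanishing_ideal B S"
    unfolding I_def by (rule P.genideal_minimal[OF vanishing_ideal_ideal]) (auto simp: G_def)
  ultimately have "vanishing_ideal B S = Idl\<^bsub>poly_ring B\<^esub> G"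
    unfolding I_def by blast
  then show ?thesis
    using G unfolding generated_in_degree_le_def B_def S_def
    by (intro exI[of _ G]) (simp add: G_def)
qed

theorem theorem1p7:
  fixes s r :: nat
    and d :: "nat \<Rightarrow> nat \<Rightarrow> nat"
    and X :: "nat \<Rightarrow> (nat \<times> nat \<Rightarrow> 'k::field) set"
  assumes "\<And>i. i < s \<Longrightarrow> zariski_closed (prod_coords r (d i)) (X i)"
    and "\<And>i. i < s \<Longrightarrow> hadamard_stable (prod_coords r (d i)) (X i)"
  shows "\<exists>D::nat. \<forall>a :: nat \<Rightarrow> nat.
    generated_in_degree_le (tensor_coords s r d a)
      (vanishing_ideal (tensor_coords s r d a) (toric_fibre_power s r d X a)) D"
proof -
  define C where "C i = prod_coords r (d i)" for i
  have C: "finite (C i)" for i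
    by (simp add: C_def finite_prod_coords)
  have "\<forall>i. \<exists>D. \<forall>\<alpha>\<in>msets (C i). \<forall>\<beta>\<in>msets (C i). agree_on (X i) \<alpha> \<beta> \<longrightarrow>
      image_mset fst \<alpha> = image_mset fst \<beta> \<longrightarrow> \<beta> < \<alpha> \<longrightarrow>
      (\<exists>p q. q \<in> msets (C i) \<and> p \<subseteq># \<alpha> \<and> agree_on (X i) p q \<and>
        image_mset fst p = image_mset fst q \<and> q < p \<and> size p \<le> D)"
    using column_step_bound[OF C] by blast
  from choice[OF this] obtain D1 where D1: "\<forall>i. \<forall>\<alpha>\<in>msets (C i). \<forall>\<beta>\<in>msets (C i). agree_on (X i) \<alpha> \<beta> \<longrightarrow>
      image_mset fst \<alpha> = image_mset fst \<beta> \<longrightarrow> \<beta> < \<alpha> \<longrightarrow>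
      (\<exists>p q. q \<in> msets (C i) \<and> p \<subseteq># \<alpha> \<and> agree_on (X i) p q \<and>
        image_mset fst p = image_mset fst q \<and> q < p \<and> size p \<le> D1 i)" ..
  from degree_step_bound[of "{..<r}" s C "\<lambda>i. agree_on (X i)"] C obtain D2 where
    D2: "\<forall>e\<in>msets {..<r}. \<forall>e'\<in>msets {..<r}. e' < e \<longrightarrow>
    (\<exists>f f'. f \<subseteq># e \<and> f' \<in> msets {..<r} \<and> f' < f \<and> size f \<le> D2 \<and> size f' \<le> D2 \<and>
      (\<forall>i<s. \<forall>\<alpha>\<in>msets (C i). \<forall>\<beta>\<in>msets (C i).
        image_mset fst \<alpha> = e \<longrightarrow> image_mset fst \<beta> = e' \<longrightarrow> agree_on (X i) \<alpha> \<beta> \<longrightarrow>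
        (\<exists>p q. p \<subseteq># \<alpha> \<and> q \<in> msets (C i) \<and> image_mset fst p = f \<and> image_mset fst q = f' \<and> agree_on (X i) p q)))"
    by auto
  \<comment> \<open>The summands pay for the swaps, for the changes of a column of each type, and
    for the changes of multidegree.\<close>
  define D where "D = 2 + (\<Sum>i<s. D1 i) + D2"
  have D1_le: "D1 i \<le> D" if "i < s" for i
    using that member_le_sum[of i "{..<s}" D1] by (simp add: D_def)
  have "D2 \<le> D" "2 \<le> D"
    by (simp_all add: D_def)
  have "generated_in_degree_le (tensor_coords s r d a)
      (vanishing_ideal (tensor_coords s r d a) (pure_tensors s r d X a)) D" for a
  proof (rule vanishing_ideal_pure_tensors_generated)
    show "\<exists>p q. q \<in> msets (prod_coords r (d i)) \<and> p \<subseteq># \<alpha> \<and> agree_on (X i) p q \<and>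
        image_mset fst p = image_mset fst q \<and> q < p \<and> size p \<le> D"
      if ab: "i < s" "\<alpha> \<in> msets (prod_coords r (d i))" "\<beta> \<in> msets (prod_coords r (d i))"
        "agree_on (X i) \<alpha> \<beta>" "image_mset fst \<alpha> = image_mset fst \<beta>" "\<beta> < \<alpha>" for i \<alpha> \<beta>
    proof -
      obtain p q where "q \<in> msets (C i)" "p \<subseteq># \<alpha>" "agree_on (X i) p q"
        "image_mset fst p = image_mset fst q" "q < p" "size p \<le> D1 i"
        using D1[rule_format, of \<alpha> i \<beta>] ab by (auto simp: C_def)
      with D1_le[OF \<open>i < s\<close>] show ?thesis
        by (intro exI[of _ p] exI[of _ q]) (simp add: C_def)
    qed
    show "\<exists>f f'. f \<subseteq># e \<and> f' \<in> msets {..<r} \<and> f' < f \<and> size f \<le> D \<and> size f' \<le> D \<and>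
      (\<forall>i<s. \<forall>\<alpha>\<in>msets (prod_coords r (d i)). \<forall>\<beta>\<in>msets (prod_coords r (d i)).
        image_mset fst \<alpha> = e \<longrightarrow> image_mset fst \<beta> = e' \<longrightarrow> agree_on (X i) \<alpha> \<beta> \<longrightarrow>
        (\<exists>p q. p \<subseteq># \<alpha> \<and> q \<in> msets (prod_coords r (d i)) \<and> image_mset fst p = f \<and>
          image_mset fst q = f' \<and> agree_on (X i) p q))"
      if "e \<in> msets {..<r}" "e' \<in> msets {..<r}" "e' < e" for e e'
    proof -
      from D2[rule_format, OF that] obtain f f' where
        "f \<subseteq># e" "f' \<in> msets {..<r}" "f' < f" "size f \<le> D2" "size f' \<le> D2"
        "\<forall>i<s. \<forall>\<alpha>\<in>msets (C i). \<forall>\<beta>\<in>msets (C i).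
          image_mset fst \<alpha> = e \<longrightarrow> image_mset fst \<beta> = e' \<longrightarrow> agree_on (X i) \<alpha> \<beta> \<longrightarrow>
          (\<exists>p q. p \<subseteq># \<alpha> \<and> q \<in> msets (C i) \<and> image_mset fst p = f \<and> image_mset fst q = f' \<and> agree_on (X i) p q)"
        by auto
      with \<open>D2 \<le> D\<close> show ?thesis
        unfolding C_def by (intro exI[of _ f] exI[of _ f']) simp
    qed
  qed (use assms(2) \<open>2 \<le> D\<close> in simp_all)
  \<comment> \<open>Passing to the Zariski closure does not change the ideal, so the bound for pure
    tensors carries over.\<close>
  moreover have "vanishing_ideal (tensor_coords s r d a) (toric_fibre_power s r d X a) =
      vanishing_ideal (tensor_coords s r d a) (pure_tensors s r d X a)" for a
    unfolding toric_fibre_power_def pure_tensors_def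
    by (rule vanishing_ideal_hull) (auto simp: pure_tensor_in_coord_space)
  ultimately show ?thesis
    by auto
qed

end
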